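(* Let $m\ge 1$, let $L$ be an $m$-component framed oriented link in $S^3$ (with components numbered $1,\dots,m$), and let $k\ge 0$ be an integer. Let $\mathcal{D}_k(m)$ be the set of all degree $k$ chord diagrams on $m$ circles, and let $\mathcal{S}_m$ be the set of symmetric matrices of size $m$ with coefficients in $\mathbb{N}=\{0,1,2,\dots\}$. For $S=(s_{ij})\in\mathcal{S}_m$ put $|S|=\sum_{1\le i\le j\le m}s_{ij}$ and $$\ell_S(L)=\prod_{1\le i\le j\le m}\frac{1}{s_{ij}!}\,\ell_{ij}(L)^{s_{ij}},$$ where $\ell_{ij}(L)$ is the linking number of the $i$th and $j$th components if $i\ne j$, and $\ell_{ii}(L)=\frac12fr_i(L)$ is half the framing of the $i$th component. Then $$\sum_{D\in\mathcal{D}_k(m)}C_L[D]=\sum_{S\in\mathcal{S}_m,\ |S|=k}\ell_S(L),$$ where $C_L[D]$ denotes the coefficient of the chord diagram $D$ in the framed Kontsevich integral $Z(L)$.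
   Context: Chord diagrams. A chord diagram on $m$ circles is a collection of finitely many chords (copies of the unit interval) whose endpoints are pairwise distinct points on the disjoint union of $m$ oriented circles numbered $1,\dots,m$, considered up to orientation-preserving homeomorphism preserving each circle. Its degree is its number of chords. $\mathcal{A}(m)$ is the $\mathbb{Q}$-vector space (completed by degree) generated by chord diagrams on $m$ circles modulo the 4T relation: for any three disjoint oriented arcs $p,q,r$ of the circles, $t_{pq}t_{pr}-t_{pr}t_{pq}+t_{pq}t_{qr}-t_{qr}t_{pq}=0$, where $t_{xy}t_{zw}$ denotes a diagram having, on these arcs, a chord joining $x,y$ and a chord joining $z,w$, stacked in the given order along the orientation, the four diagrams being identical elsewhere. The same definitions apply to diagrams on any oriented 1-manifold. Coefficients. $C[D](A)$ denotes the coefficient of $D$ in $A\in\mathcal{A}(m)$, and $C_L[D]:=C[D](Z(L))$. An individual coefficient is in general not well defined because of the 4T relation; a sum $\sum_{D\in\mathcal{D}}C[D]$ is understood as the linear functional sending a chord diagram to $1$ if it lies in $\mathcal{D}$ and to $0$ otherwise, evaluated on any representative; it is well defined on $\mathcal{A}(m)$ when it vanishes on all 4T relators, which is the case for $\mathcal{D}=\mathcal{D}_k(m)$. Framed Kontsevich integral $Z$ (Le–Murakami). A framed q-tangle is a framed oriented tangle with a parenthesization on both sets of boundary points; each decomposes, under composition and juxtaposition, into elementary q-tangles: $I$ (trivial strand), $X_\pm$ (positive/negative crossing of two upward strands), $C_\pm$ (cap and cup), $\Lambda_\pm$ (change of parenthesization of trivial strands), and those obtained by reversing orientations of components. $Z$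 is the multiplicative invariant with values in spaces of chord diagrams on the underlying 1-manifolds determined by: $Z(I)$ is the strand without chords; $Z(X_\pm)=\sum_{k\ge0}\frac{(\pm1)^k}{2^kk!}X_k$, where $X_k$ consists of the two crossing strands joined by $k$ parallel chords; $Z(C_\pm)=\sqrt{\nu}$; $Z(\Lambda_\pm)=\Phi^{\pm1}$ with $\Phi$ a Drinfeld associator (with the usual cabling of strands; the value on links is independent of its choice). Reversing the orientation of a strand reverses it in the diagrams and multiplies by $(-1)^{\#\text{chord endpoints on it}}$. Here $\nu=Z(U_0)\in\mathcal{A}(1)$ is the value on the $0$-framed unknot, $\nu=\chi\big(\exp_\sqcup(\sum_{n\ge1}b_{2n}W_{2n})\big)$, where $W_{2n}$ is the wheel with $2n$ univalent vertices, $b_{2n}$ is the coefficient of $x^{2n}$ in $\frac12\ln\frac{\sinh(x/2)}{x/2}$, $\exp_\sqcup$ is the exponential for disjoint union, and $\chi$ averages over all ways of attaching univalent vertices to the circle and then recursively applies the STU relation (a trivalent vertex adjacent to the circle is the difference of the two ways of attaching its two other legs directly to the circle) to obtain chord diagrams. Framings are integers; $0^0=1$. *)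

theory Defs
  imports
    Complex_Main
    "HOL-Library.Poly_Mapping"
    "HOL-Computational_Algebra.Formal_Power_Series"
    "HOL-Combinatorics.Multiset_Permutations"
    "Jordan_Normal_Form.Matrix"
begin

section \<open>Formal linear combinations\<close>

text \<open>The free rational vector space on a set of generators is the type of finitely supported
  functions; a completed graded space is rendered as sequences whose \<open>k\<close>-th entry is the part
  of degree \<open>k\<close>.\<close>

type_synonym 'a lin = "'a \<Rightarrow>\<^sub>0 rat"
type_synonym 'a graded = "nat \<Rightarrow> 'a lin"

abbreviation gen :: "'a \<Rightarrow> 'a lin" where
  "gen a \<equiv> Poly_Mapping.single a 1"

definition smul :: "rat \<Rightarrow> 'a lin \<Rightarrow> 'a lin" where
  "smul c x = Poly_Mapping.map ((*) c) x"

abbreviation lin_span :: "'a lin set \<Rightarrow> 'a lin set" where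
  "lin_span \<equiv> module.span smul"

definition lin_ext :: "('a \<Rightarrow> 'b) \<Rightarrow> 'a lin \<Rightarrow> 'b lin" where
  "lin_ext f x = (\<Sum>a\<in>Poly_Mapping.keys x. smul (Poly_Mapping.lookup x a) (gen (f a)))"

definition bilin_ext :: "('a \<Rightarrow> 'b \<Rightarrow> 'c) \<Rightarrow> 'a lin \<Rightarrow> 'b lin \<Rightarrow> 'c lin" where
  "bilin_ext f x y = (\<Sum>a\<in>Poly_Mapping.keys x. \<Sum>b\<in>Poly_Mapping.keys y.
     smul (Poly_Mapping.lookup x a * Poly_Mapping.lookup y b) (gen (f a b)))"

definition graded_ext :: "('a \<Rightarrow> 'b \<Rightarrow> 'c) \<Rightarrow> 'a graded \<Rightarrow> 'b graded \<Rightarrow> 'c graded" where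
  "graded_ext f x y k = (\<Sum>i\<le>k. bilin_ext f (x i) (y (k - i)))"

definition in_degree_0 :: "'a \<Rightarrow> 'a graded" where
  "in_degree_0 a k = (if k = 0 then gen a else 0)"

section \<open>Chord diagrams on circles and the 4T relation\<close>

text \<open>A code for a chord diagram on \<open>m\<close> circles lists, for each circle, the chord endpoints met
  when running once along the circle from an arbitrary base point; both endpoints of a chord carry
  the name of the chord. A chord diagram is a class of codes under moving the base points and
  renaming the chords. The circles are numbered \<open>0, \<dots>, m - 1\<close>.\<close>

definition is_code :: "nat \<Rightarrow> nat list list \<Rightarrow> bool" where
  "is_code m ws \<longleftrightarrow> length ws = m \<and> (\<forall>x\<in>set (concat ws). count_list (concat ws) x = 2)"

definition code_rel :: "nat \<Rightarrow> (nat list list \<times> nat list list) set" where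
  "code_rel m = {(vs, ws). is_code m vs \<and> is_code m ws \<and>
     (\<exists>f. inj_on f (set (concat vs)) \<and> (\<forall>i<m. \<exists>r. ws ! i = rotate r (map f (vs ! i))))}"

type_synonym chord_diagram = "nat list list set"

definition diagram_of_code :: "nat \<Rightarrow> nat list list \<Rightarrow> chord_diagram" where
  "diagram_of_code m ws = code_rel m `` {ws}"

definition chord_diagrams :: "nat \<Rightarrow> nat \<Rightarrow> chord_diagram set" where
  "chord_diagrams m k = {ws. is_code m ws \<and> length (concat ws) = 2 * k} // code_rel m"

definition subst_letters :: "(nat \<Rightarrow> nat list) \<Rightarrow> nat list \<Rightarrow> nat list" where
  "subst_letters \<sigma> w = concat (map \<sigma> w)"

definition fill_arcs ::
  "nat \<Rightarrow> nat \<Rightarrow> nat \<Rightarrow> nat list list \<Rightarrow> nat list \<Rightarrow> nat list \<Rightarrow> nat list \<Rightarrow> nat list list" where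
  "fill_arcs p q r ws u v w = map (subst_letters ((\<lambda>x. [x])(p := u, q := v, r := w))) ws"

text \<open>In a 4T template the letters \<open>p\<close>, \<open>q\<close>, \<open>r\<close> mark three disjoint arcs. They are replaced by
  the endpoints, in the order along the arc, of the two chords \<open>a\<close>, \<open>b\<close>; the four terms are
  \<open>t\<^sub>p\<^sub>q t\<^sub>p\<^sub>r\<close>, \<open>t\<^sub>p\<^sub>r t\<^sub>p\<^sub>q\<close>, \<open>t\<^sub>p\<^sub>q t\<^sub>q\<^sub>r\<close> and \<open>t\<^sub>q\<^sub>r t\<^sub>p\<^sub>q\<close>.\<close>

definition is_4T_template :: "nat \<Rightarrow> nat \<Rightarrow> nat \<Rightarrow> nat \<Rightarrow> nat list list \<Rightarrow> bool" where
  "is_4T_template m p q r ws \<longleftrightarrow> length ws = m \<and> distinct [p, q, r] \<and>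
     (\<forall>x\<in>{p, q, r}. count_list (concat ws) x = 1) \<and>
     (\<forall>x\<in>set (concat ws) - {p, q, r}. count_list (concat ws) x = 2)"

definition relators_4T :: "nat \<Rightarrow> chord_diagram lin set" where
  "relators_4T m =
    {gen (diagram_of_code m (fill_arcs p q r ws [a, b] [a] [b]))
      - gen (diagram_of_code m (fill_arcs p q r ws [b, a] [a] [b]))
      + gen (diagram_of_code m (fill_arcs p q r ws [a] [a, b] [b]))
      - gen (diagram_of_code m (fill_arcs p q r ws [a] [b, a] [b]))
     | p q r ws a b. is_4T_template m p q r ws \<and> a \<noteq> b \<and> {a, b} \<inter> set (concat ws) = {}}"

text \<open>The elements of \<open>\<A>(m)\<close> are the cosets of the following form. The relators being
  homogeneous, the completion amounts to imposing the relations degree by degree.\<close>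

definition class_A :: "nat \<Rightarrow> chord_diagram graded \<Rightarrow> chord_diagram graded set" where
  "class_A m z = {y. \<forall>k. y k - z k \<in> lin_span (relators_4T m)}"

section \<open>Drinfeld associators\<close>

text \<open>A noncommutative power series is the function mapping each word to its coefficient.
  Products are read from left to right as stacking from bottom to top, matching the composition
  of tangles below; this is opposite to the right-to-left convention in which the pentagon and
  hexagon equations are often printed.\<close>

type_synonym 'g ncseries = "'g list \<Rightarrow> rat"

definition nc_mult :: "'g ncseries \<Rightarrow> 'g ncseries \<Rightarrow> 'g ncseries" (infixl "\<odot>" 70) where
  "(f \<odot> g) w = (\<Sum>i\<le>length w. f (take i w) * g (drop i w))"

definition nc_one :: "'g ncseries" where
  "nc_one w = (if w = [] then 1 else 0)"

definition nc_inverse :: "'g ncseries \<Rightarrow> 'g ncseries" where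
  "nc_inverse f = (THE g. f \<odot> g = nc_one \<and> g \<odot> f = nc_one)"

text \<open>The letters \<open>True\<close>, \<open>False\<close> are the two free generators \<open>A\<close>, \<open>B\<close>. The coproduct making
  them primitive sends a word to the sum over all ways of splitting it into a subword and the
  complementary subword; group-like means that \<open>\<Phi>\<close> is mapped to \<open>\<Phi> \<otimes> \<Phi>\<close>.\<close>

definition group_like :: "bool ncseries \<Rightarrow> bool" where
  "group_like \<Phi> \<longleftrightarrow> \<Phi> [] = 1 \<and>
     (\<forall>u v. (\<Sum>(w, I)\<in>{(w, I). length w = length u + length v \<and> I \<subseteq> {..<length w} \<and>
                nths w I = u \<and> nths w ({..<length w} - I) = v}. \<Phi> w) = \<Phi> u * \<Phi> v)"

text \<open>The Drinfeld--Kohno algebra on \<open>n\<close> strands has generators \<open>t\<^sub>i\<^sub>j = t\<^sub>j\<^sub>i\<close>, here the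
  two-element sets \<open>{i, j}\<close>, subject to \<open>[t\<^sub>i\<^sub>j, t\<^sub>k\<^sub>l] = 0\<close> and \<open>[t\<^sub>i\<^sub>j, t\<^sub>i\<^sub>k + t\<^sub>j\<^sub>k] = 0\<close> for
  distinct indices.\<close>

type_synonym dk_word = "nat set list"

definition dk_gens :: "nat \<Rightarrow> nat set set" where
  "dk_gens n = {{i, j} | i j. i \<in> {1..n} \<and> j \<in> {1..n} \<and> i \<noteq> j}"

definition dk_commutator :: "dk_word \<Rightarrow> nat set \<Rightarrow> nat set \<Rightarrow> dk_word \<Rightarrow> dk_word lin" where
  "dk_commutator u s t v = gen (u @ [s, t] @ v) - gen (u @ [t, s] @ v)"

definition dk_relators :: "nat \<Rightarrow> dk_word lin set" where
  "dk_relators n =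
     {dk_commutator u {i, j} {k, l} v | u v i j k l.
        set u \<union> set v \<subseteq> dk_gens n \<and> {i, j, k, l} \<subseteq> {1..n} \<and> distinct [i, j, k, l]} \<union>
     {dk_commutator u {i, j} {i, k} v + dk_commutator u {i, j} {j, k} v | u v i j k.
        set u \<union> set v \<subseteq> dk_gens n \<and> {i, j, k} \<subseteq> {1..n} \<and> distinct [i, j, k]}"

definition dk_eq :: "nat \<Rightarrow> nat set ncseries \<Rightarrow> nat set ncseries \<Rightarrow> bool" where
  "dk_eq n f g \<longleftrightarrow> (\<forall>k. (\<Sum>w | length w = k \<and> set w \<subseteq> dk_gens n. smul (f w - g w) (gen w))
      \<in> lin_span (dk_relators n))"

text \<open>\<open>subst2 \<Phi> X Y\<close> is \<open>\<Phi>(\<Sum>X, \<Sum>Y)\<close> for disjoint sets of generators, and \<open>half_exp X\<close> is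
  \<open>exp (\<onehalf> \<Sum>X)\<close>.\<close>

definition subst2 :: "bool ncseries \<Rightarrow> 'g set \<Rightarrow> 'g set \<Rightarrow> 'g ncseries" where
  "subst2 \<Phi> X Y w = (if set w \<subseteq> X \<union> Y then \<Phi> (map (\<lambda>g. g \<in> X) w) else 0)"

definition half_exp :: "'g set \<Rightarrow> 'g ncseries" where
  "half_exp X w = (if set w \<subseteq> X then 1 / (2 ^ length w * fact (length w)) else 0)"

definition drinfeld_associator :: "bool ncseries \<Rightarrow> bool" where
  "drinfeld_associator \<Phi> \<longleftrightarrow>
     (let P = subst2 \<Phi>; N = subst2 (nc_inverse \<Phi>);
          E = half_exp; t = (\<lambda>i j. {{i, j}} :: nat set set)
      in group_like \<Phi> \<and>
         subst2 \<Phi> {False} {True} = nc_inverse \<Phi> \<and>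
         dk_eq 4 (P (t 1 3 \<union> t 2 3) (t 3 4) \<odot> P (t 1 2) (t 2 3 \<union> t 2 4))
           (P (t 1 2) (t 2 3) \<odot> P (t 1 2 \<union> t 1 3) (t 2 4 \<union> t 3 4) \<odot> P (t 2 3) (t 3 4)) \<and>
         dk_eq 3 (E (t 1 3 \<union> t 2 3))
           (P (t 1 2) (t 2 3) \<odot> E (t 2 3) \<odot> N (t 1 3) (t 2 3) \<odot> E (t 1 3) \<odot> P (t 1 3) (t 1 2)) \<and>
         dk_eq 3 (E (t 1 2 \<union> t 1 3))
           (N (t 1 2) (t 2 3) \<odot> E (t 1 2) \<odot> P (t 1 2) (t 1 3) \<odot> E (t 1 3) \<odot> N (t 2 3) (t 1 3)))"

section \<open>The value of the unknot\<close>

text \<open>A Jacobi diagram on an oriented interval is a word of edge names (the univalent vertices, in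
  their order on the interval) with a list of trivalent vertices, given as cyclically ordered
  triples of edge names. STU is applied to the vertices in turn; the first entry of the vertex is
  the edge attached to the interval. The opposite sign convention for STU would not change the
  result on wheels with an even number of legs.\<close>

fun stu_resolve :: "nat list \<Rightarrow> (nat \<times> nat \<times> nat) list \<Rightarrow> nat list lin" where
  "stu_resolve w [] = gen w"
| "stu_resolve w ((l, e, f) # vs) =
     stu_resolve (subst_letters ((\<lambda>x. [x])(l := [e, f])) w) vs
     - stu_resolve (subst_letters ((\<lambda>x. [x])(l := [f, e])) w) vs"

text \<open>The wheel with \<open>n\<close> legs; the leg \<open>i\<close> is named \<open>c + i\<close>, the rim edges follow.\<close>

definition wheel :: "nat \<Rightarrow> nat \<Rightarrow> (nat \<times> nat \<times> nat) list" where
  "wheel c n = map (\<lambda>i. (c + i, c + n + i, c + n + (Suc i mod n))) [0..<n]"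

fun wheels :: "nat \<Rightarrow> nat list \<Rightarrow> (nat \<times> nat \<times> nat) list" where
  "wheels c [] = []"
| "wheels c (n # ns) = wheel c n @ wheels (c + 2 * n) ns"

definition chi :: "(nat \<times> nat \<times> nat) list \<Rightarrow> nat list lin" where
  "chi vs = smul (1 / fact (length vs))
     (\<Sum>w\<in>permutations_of_set (set (map fst vs)). stu_resolve w vs)"

text \<open>\<open>wheel_coeff n\<close> is the coefficient of \<open>x ^ n\<close> in \<open>\<onehalf> ln (sinh (x/2) / (x/2))\<close>.\<close>

definition wheel_coeff :: "nat \<Rightarrow> rat" where
  "wheel_coeff n = fps_nth (fps_const (1/2) *
     (fps_ln 1 oo ((fps_exp (1/2) - fps_exp (- (1/2))) / fps_X - 1))) n"

text \<open>Cutting the circle open identifies \<open>\<A>(1)\<close> with the space of diagrams on an interval, where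
  multiplication is concatenation; averaging over the linear orders of the legs on the interval
  gives, after closing up, the average over their cyclic orders on the circle. In degree \<open>k\<close> the
  exponential is a sum over the lists \<open>ns\<close> of positive integers, standing for the ordered
  disjoint unions of the wheels with \<open>2n\<close> legs.\<close>

definition nu :: "nat list graded" where
  "nu k = (\<Sum>ns | 0 \<notin> set ns \<and> 2 * sum_list ns = k.
     smul ((\<Prod>n\<leftarrow>ns. wheel_coeff (2 * n)) / fact (length ns))
       (chi (wheels 0 (map ((*) 2) ns))))"

definition even_name :: "nat \<Rightarrow> nat" where
  "even_name x = 2 * x"

definition odd_name :: "nat \<Rightarrow> nat" where
  "odd_name x = 2 * x + 1"

definition word_mult :: "nat list graded \<Rightarrow> nat list graded \<Rightarrow> nat list graded" where
  "word_mult = graded_ext (\<lambda>u v. map even_name u @ map odd_name v)"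

fun word_power :: "nat list graded \<Rightarrow> nat \<Rightarrow> nat list graded" where
  "word_power x 0 = in_degree_0 []"
| "word_power x (Suc n) = word_mult x (word_power x n)"

text \<open>Binomial series of \<open>(1 + (\<nu> - 1)) ^ \<onehalf>\<close>; powers above \<open>k\<close> do not contribute in degree
  \<open>k\<close>.\<close>

definition sqrt_nu :: "nat list graded" where
  "sqrt_nu k = (\<Sum>n\<le>k. smul ((1/2) gchoose n)
     (word_power (\<lambda>d. nu d - in_degree_0 [] d) n k))"

section \<open>Framed oriented q-tangles\<close>

text \<open>Strands carry the number of the component of the link they belong to and their direction at
  the boundary point (\<open>True\<close> for upward). The empty word is a strict unit for juxtaposition of
  parenthesized words.\<close>

type_synonym strand = "nat \<times> bool"

datatype bword = Empty | Pt strand | Br bword bword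

fun juxt :: "bword \<Rightarrow> bword \<Rightarrow> bword" where
  "juxt Empty v = v"
| "juxt u Empty = u"
| "juxt u v = Br u v"

fun strands :: "bword \<Rightarrow> strand list" where
  "strands Empty = []"
| "strands (Pt s) = [s]"
| "strands (Br u v) = strands u @ strands v"

abbreviation opp :: "strand \<Rightarrow> strand" where
  "opp s \<equiv> (fst s, \<not> snd s)"

text \<open>Tangles run from bottom to top, with the blackboard framing. \<open>Crossing \<epsilon> a b\<close> has \<open>a\<close>
  running from bottom left to top right and \<open>b\<close> from bottom right to top left; \<open>\<epsilon>\<close> tells whether
  it is positive after orienting both strands upward, i.e. whether \<open>a\<close> passes over \<open>b\<close>.
  The argument of \<open>Cap\<close> and \<open>Cup\<close> is the left boundary point. \<open>Assoc True u v w\<close> changes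
  \<open>(u v) w\<close> to \<open>u (v w)\<close>. \<open>Comp S T\<close> has \<open>T\<close> on top of \<open>S\<close>, and \<open>Juxt S T\<close> has \<open>T\<close> to the right
  of \<open>S\<close>.\<close>

datatype qtangle =
    Strand strand
  | Crossing bool strand strand
  | Cap strand
  | Cup strand
  | Assoc bool bword bword bword
  | Comp qtangle qtangle
  | Juxt qtangle qtangle

fun bottom :: "qtangle \<Rightarrow> bword" and top_word :: "qtangle \<Rightarrow> bword" where
  "bottom (Strand a) = Pt a"
| "bottom (Crossing \<epsilon> a b) = Br (Pt a) (Pt b)"
| "bottom (Cap a) = Br (Pt a) (Pt (opp a))"
| "bottom (Cup a) = Empty"
| "bottom (Assoc \<epsilon> u v w) = (if \<epsilon> then juxt (juxt u v) w else juxt u (juxt v w))"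
| "bottom (Comp S T) = bottom S"
| "bottom (Juxt S T) = juxt (bottom S) (bottom T)"
| "top_word (Strand a) = Pt a"
| "top_word (Crossing \<epsilon> a b) = Br (Pt b) (Pt a)"
| "top_word (Cap a) = Empty"
| "top_word (Cup a) = Br (Pt a) (Pt (opp a))"
| "top_word (Assoc \<epsilon> u v w) = (if \<epsilon> then juxt u (juxt v w) else juxt (juxt u v) w)"
| "top_word (Comp S T) = top_word T"
| "top_word (Juxt S T) = juxt (top_word S) (top_word T)"

fun is_qtangle :: "qtangle \<Rightarrow> bool" where
  "is_qtangle (Comp S T) \<longleftrightarrow> is_qtangle S \<and> is_qtangle T \<and> top_word S = bottom T"
| "is_qtangle (Juxt S T) \<longleftrightarrow> is_qtangle S \<and> is_qtangle T"
| "is_qtangle _ \<longleftrightarrow> True"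

section \<open>Chord diagrams on tangles\<close>

text \<open>Boundary points are numbered from the left; \<open>Mid\<close> is only used while gluing. The word of an
  arc or circle lists the names of the chord endpoints along its orientation.\<close>

datatype point = Bot nat | Mid nat | Top nat

datatype arc = Arc (colour: nat) (start: point) (chords: "nat list") (finish: point)

type_synonym tangle_diagram = "arc list \<times> (nat \<times> nat list) list"

text \<open>\<open>arc_between (c, up) p w q\<close> runs from \<open>p\<close> to \<open>q\<close> if \<open>up\<close> holds and from \<open>q\<close> to \<open>p\<close>
  otherwise; in both cases \<open>w\<close> lists the chord endpoints met when going from \<open>p\<close> to \<open>q\<close>.\<close>

fun arc_between :: "strand \<Rightarrow> point \<Rightarrow> nat list \<Rightarrow> point \<Rightarrow> arc" where
  "arc_between (c, up) p w q = (if up then Arc c p w q else Arc c q (rev w) p)"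

fun rename_arc :: "(point \<Rightarrow> point) \<Rightarrow> (nat \<Rightarrow> nat) \<Rightarrow> arc \<Rightarrow> arc" where
  "rename_arc g f (Arc c p w q) = Arc c (g p) (map f w) (g q)"

definition rename_circle :: "(nat \<Rightarrow> nat) \<Rightarrow> nat \<times> nat list \<Rightarrow> nat \<times> nat list" where
  "rename_circle f = map_prod id (map f)"

fun shift_point :: "nat \<Rightarrow> nat \<Rightarrow> point \<Rightarrow> point" where
  "shift_point b t (Bot i) = Bot (b + i)"
| "shift_point b t (Top i) = Top (t + i)"
| "shift_point b t (Mid i) = Mid i"

fun juxt_diagrams :: "nat \<Rightarrow> nat \<Rightarrow> tangle_diagram \<Rightarrow> tangle_diagram \<Rightarrow> tangle_diagram" where
  "juxt_diagrams b t (as, cs) (as', cs') =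
     (map (rename_arc id even_name) as @ map (rename_arc (shift_point b t) odd_name) as',
      map (rename_circle even_name) cs @ map (rename_circle odd_name) cs')"

text \<open>Join the arc ending at \<open>p\<close> to the arc starting at \<open>p\<close>; if they coincide, this closes a
  circle.\<close>

fun join_at :: "point \<Rightarrow> tangle_diagram \<Rightarrow> tangle_diagram" where
  "join_at p (as, cs) =
     (case (find (\<lambda>x. finish x = p) as, find (\<lambda>x. start x = p) as) of
        (Some a, Some b) \<Rightarrow>
          (let rest = filter (\<lambda>x. start x \<noteq> p \<and> finish x \<noteq> p) as
           in if start a = p then (rest, (colour a, chords a) # cs)
              else (Arc (colour a) (start a) (chords a @ chords b) (finish b) # rest, cs))
      | _ \<Rightarrow> (as, cs))"

fun top_to_mid :: "point \<Rightarrow> point" where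
  "top_to_mid (Top i) = Mid i"
| "top_to_mid p = p"

fun bot_to_mid :: "point \<Rightarrow> point" where
  "bot_to_mid (Bot i) = Mid i"
| "bot_to_mid p = p"

text \<open>Glue the second diagram on top of the first one along \<open>n\<close> points.\<close>

fun comp_diagrams :: "nat \<Rightarrow> tangle_diagram \<Rightarrow> tangle_diagram \<Rightarrow> tangle_diagram" where
  "comp_diagrams n (as, cs) (as', cs') = fold join_at (map Mid [0..<n])
     (map (rename_arc top_to_mid even_name) as @ map (rename_arc bot_to_mid odd_name) as',
      map (rename_circle even_name) cs @ map (rename_circle odd_name) cs')"

text \<open>The \<open>i\<close>-th bottom point is joined to the \<open>\<pi> i\<close>-th top point, and \<open>ws i\<close> lists the chord
  endpoints on this strand from bottom to top, whatever its direction.\<close>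

definition braid_diagram ::
  "strand list \<Rightarrow> (nat \<Rightarrow> nat) \<Rightarrow> (nat \<Rightarrow> nat list) \<Rightarrow> tangle_diagram" where
  "braid_diagram ss \<pi> ws =
     (map (\<lambda>i. arc_between (ss ! i) (Bot i) (ws i) (Top (\<pi> i))) [0..<length ss], [])"

definition crossing_diagram :: "strand \<Rightarrow> strand \<Rightarrow> nat list \<Rightarrow> tangle_diagram" where
  "crossing_diagram a b w = braid_diagram [a, b] (\<lambda>i. 1 - i) (\<lambda>_. w)"

definition cap_diagram :: "strand \<Rightarrow> nat list \<Rightarrow> tangle_diagram" where
  "cap_diagram a w = ([arc_between a (Bot 0) w (Bot 1)], [])"

definition cup_diagram :: "strand \<Rightarrow> nat list \<Rightarrow> tangle_diagram" where
  "cup_diagram a w = ([arc_between a (Top 1) w (Top 0)], [])"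

text \<open>Vertical strands with horizontal chords, listed from bottom to top; the \<open>n\<close>-th chord joins
  the two strands whose positions form the \<open>n\<close>-th entry of \<open>hs\<close>.\<close>

definition horizontal_diagram :: "strand list \<Rightarrow> (nat \<times> nat) list \<Rightarrow> tangle_diagram" where
  "horizontal_diagram ss hs = braid_diagram ss id
     (\<lambda>i. filter (\<lambda>n. fst (hs ! n) = i \<or> snd (hs ! n) = i) [0..<length hs])"

fun skeleton :: "qtangle \<Rightarrow> tangle_diagram" where
  "skeleton (Strand a) = braid_diagram [a] id (\<lambda>_. [])"
| "skeleton (Crossing \<epsilon> a b) = crossing_diagram a b []"
| "skeleton (Cap a) = cap_diagram a []"
| "skeleton (Cup a) = cup_diagram a []"
| "skeleton (Assoc \<epsilon> u v w) = horizontal_diagram (strands u @ strands v @ strands w) []"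
| "skeleton (Comp S T) =
     comp_diagrams (length (strands (top_word S))) (skeleton S) (skeleton T)"
| "skeleton (Juxt S T) =
     juxt_diagrams (length (strands (bottom S))) (length (strands (top_word S)))
       (skeleton S) (skeleton T)"

text \<open>A presentation of a framed oriented link with components numbered \<open>0, \<dots>, m - 1\<close>: a closed
  q-tangle in which every number labels exactly one circle.\<close>

definition is_framed_link :: "nat \<Rightarrow> qtangle \<Rightarrow> bool" where
  "is_framed_link m L \<longleftrightarrow> is_qtangle L \<and> bottom L = Empty \<and> top_word L = Empty \<and>
     distinct (map fst (snd (skeleton L))) \<and> set (map fst (snd (skeleton L))) = {..<m}"

section \<open>The framed Kontsevich integral\<close>

text \<open>Reversing a strand multiplies a diagram by \<open>-1\<close> for every chord endpoint on it;
  \<open>dir\<close> is the resulting factor for one endpoint.\<close>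

definition dir :: "strand \<Rightarrow> rat" where
  "dir s = (if snd s then 1 else -1)"

definition Z_crossing :: "bool \<Rightarrow> strand \<Rightarrow> strand \<Rightarrow> tangle_diagram graded" where
  "Z_crossing \<epsilon> a b k =
     smul ((if \<epsilon> then 1 else -1) ^ k / (2 ^ k * fact k) * dir a ^ k * dir b ^ k)
       (gen (crossing_diagram a b [0..<k]))"

text \<open>Cabling replaces \<open>t\<^sub>1\<^sub>2\<close> by the sum of all chords joining a strand of \<open>u\<close> to a strand of \<open>v\<close>,
  and \<open>t\<^sub>2\<^sub>3\<close> by the sum of all chords joining a strand of \<open>v\<close> to a strand of \<open>w\<close>.\<close>

definition cabling :: "bool ncseries \<Rightarrow> strand list \<Rightarrow> strand list \<Rightarrow> strand list
    \<Rightarrow> tangle_diagram graded" where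
  "cabling \<Phi> u v w k =
     (let ss = u @ v @ w;
          U = {..<length u};
          V = {length u..<length u + length v};
          W = {length u + length v..<length ss}
      in \<Sum>hs | length hs = k \<and> set hs \<subseteq> U \<times> V \<union> V \<times> W.
           smul (\<Phi> (map (\<lambda>(i, j). i \<in> U) hs) * (\<Prod>(i, j)\<leftarrow>hs. dir (ss ! i) * dir (ss ! j)))
             (gen (horizontal_diagram ss hs)))"

text \<open>On caps and cups the sign for reversing the strand is trivial, the number of chord endpoints
  on it being even.\<close>

fun Z_tangle :: "bool ncseries \<Rightarrow> qtangle \<Rightarrow> tangle_diagram graded" where
  "Z_tangle \<Phi> (Strand a) = in_degree_0 (braid_diagram [a] id (\<lambda>_. []))"
| "Z_tangle \<Phi> (Crossing \<epsilon> a b) = Z_crossing \<epsilon> a b"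
| "Z_tangle \<Phi> (Cap a) = (\<lambda>k. lin_ext (cap_diagram a) (sqrt_nu k))"
| "Z_tangle \<Phi> (Cup a) = (\<lambda>k. lin_ext (cup_diagram a) (sqrt_nu k))"
| "Z_tangle \<Phi> (Assoc \<epsilon> u v w) =
     cabling (if \<epsilon> then \<Phi> else nc_inverse \<Phi>) (strands u) (strands v) (strands w)"
| "Z_tangle \<Phi> (Comp S T) =
     graded_ext (comp_diagrams (length (strands (top_word S)))) (Z_tangle \<Phi> S) (Z_tangle \<Phi> T)"
| "Z_tangle \<Phi> (Juxt S T) =
     graded_ext (juxt_diagrams (length (strands (bottom S))) (length (strands (top_word S))))
       (Z_tangle \<Phi> S) (Z_tangle \<Phi> T)"

definition closed_diagram :: "nat \<Rightarrow> tangle_diagram \<Rightarrow> chord_diagram" where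
  "closed_diagram m D = diagram_of_code m (map (\<lambda>i. the (map_of (snd D) i)) [0..<m])"

text \<open>The value in \<open>\<A>(m)\<close> on a link, as the set of all its representatives.\<close>

definition kontsevich :: "bool ncseries \<Rightarrow> nat \<Rightarrow> qtangle \<Rightarrow> chord_diagram graded set" where
  "kontsevich \<Phi> m L = class_A m (\<lambda>k. lin_ext (closed_diagram m) (Z_tangle \<Phi> L k))"

section \<open>Linking numbers\<close>

fun crossings :: "qtangle \<Rightarrow> (rat \<times> nat \<times> nat) list" where
  "crossings (Crossing \<epsilon> a b) = [((if \<epsilon> then 1 else -1) * dir a * dir b, fst a, fst b)]"
| "crossings (Comp S T) = crossings S @ crossings T"
| "crossings (Juxt S T) = crossings S @ crossings T"
| "crossings _ = []"

definition linking_number :: "qtangle \<Rightarrow> nat \<Rightarrow> nat \<Rightarrow> rat" where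
  "linking_number L i j = (\<Sum>(s, a, b)\<leftarrow>crossings L. if {a, b} = {i, j} then s else 0) / 2"

text \<open>The blackboard framing: the signed number of self-crossings.\<close>

definition framing :: "qtangle \<Rightarrow> nat \<Rightarrow> rat" where
  "framing L i = (\<Sum>(s, a, b)\<leftarrow>crossings L. if a = i \<and> b = i then s else 0)"

definition ell :: "qtangle \<Rightarrow> nat \<Rightarrow> nat \<Rightarrow> rat" where
  "ell L i j = (if i = j then framing L i / 2 else linking_number L i j)"

definition sym_mats :: "nat \<Rightarrow> nat mat set" where
  "sym_mats m = {S \<in> carrier_mat m m. transpose_mat S = S}"

definition mat_size :: "nat \<Rightarrow> nat mat \<Rightarrow> nat" where
  "mat_size m S = (\<Sum>(i, j) | i \<le> j \<and> j < m. S $$ (i, j))"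

definition ell_mat :: "nat \<Rightarrow> qtangle \<Rightarrow> nat mat \<Rightarrow> rat" where
  "ell_mat m L S = (\<Prod>(i, j) | i \<le> j \<and> j < m. ell L i j ^ (S $$ (i, j)) / fact (S $$ (i, j)))"

end

theory Submission
  imports Defs
begin

text \<open>Sending every chord diagram to \<open>1\<close> kills the 4T relators and turns gluing of diagrams into
  multiplication of power series, so the series of coefficient sums of \<open>Z\<close> is the product of
  those of the elementary tangles. STU annihilates every wheel, hence \<open>\<nu>\<close> and \<open>\<surd>\<nu>\<close> contribute \<open>1\<close>. The
  abelianization of a group-like \<open>\<Phi>\<close> is the exponential of its linear part, which the pentagon
  equation forces to vanish, so associators contribute \<open>1\<close> as well. A crossing of sign \<open>s\<close> contributes
  \<open>exp (s x / 2)\<close>. The product is \<open>exp (x \<Sum>\<^sub>i\<^sub>\<le>\<^sub>j \<ell>\<^sub>i\<^sub>j)\<close>, and the multinomial theorem expands its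
  coefficient of degree \<open>k\<close>.\<close>

section \<open>The sum of the coefficients\<close>

text \<open>The functional adding up all coefficients is multiplicative for any gluing operation,
  but the sum in the theorem runs over genuine chord diagrams of degree k only. The two agree on a
  representative of Z(L) once every generator in its support is known to be a valid code with
  exactly k chords. Codes are mere lists of names, and gluing is a fold of list operations that
  could in principle lose arcs. A large part of the proof therefore follows supports: which boundary
  points the arcs occupy, how often each chord name occurs, and how circles are labelled. The 4T
  relator cancels in two pairs, each differing by the exchange of two adjacent endpoints; validity
  and degree see only the multiset of names, hence not the exchange. The two normalisations in
  \<open>ell\<close> (half the framing on the diagonal, half a signed count off it) give every
  crossing of sign s the same weight s/2, which is why only the sum of all \<open>ell\<close>
  survives.\<close>

lemma lookup_smul [simp]: "Poly_Mapping.lookup (smul c x) a = c * Poly_Mapping.lookup x a"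
  by (simp add: smul_def Poly_Mapping.map.rep_eq when_def)

lemma keys_smul: "Poly_Mapping.keys (smul c x) \<subseteq> Poly_Mapping.keys x"
  by (auto simp: in_keys_iff)

interpretation lin: Modules.module smul
  by unfold_locales (auto intro!: poly_mapping_eqI simp: lookup_add algebra_simps)

text \<open>The augmentation of the free module. It counts every generator, whether or not it is a
  valid diagram.\<close>

definition aug :: "'a lin \<Rightarrow> rat" where
  "aug x = (\<Sum>a\<in>Poly_Mapping.keys x. Poly_Mapping.lookup x a)"

lemma aug_superset:
  assumes "finite K" "Poly_Mapping.keys x \<subseteq> K"
  shows "aug x = (\<Sum>a\<in>K. Poly_Mapping.lookup x a)"
  unfolding aug_def using assms by (intro sum.mono_neutral_left) (auto simp: in_keys_iff)

lemma aug_zero [simp]: "aug 0 = 0"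
  by (simp add: aug_def)

lemma aug_gen [simp]: "aug (gen a) = 1"
  by (simp add: aug_def)

lemma aug_add [simp]: "aug (x + y) = aug x + aug y"
proof -
  let ?K = "Poly_Mapping.keys x \<union> Poly_Mapping.keys y"
  have "aug (x + y) = (\<Sum>a\<in>?K. Poly_Mapping.lookup (x + y) a)"
    by (rule aug_superset) (simp_all add: Poly_Mapping.keys_add)
  also have "\<dots> = aug x + aug y"
    by (simp add: lookup_add sum.distrib aug_superset[of ?K])
  finally show ?thesis .
qed

lemma aug_smul [simp]: "aug (smul c x) = c * aug x"
  by (simp add: aug_superset[OF _ keys_smul[of c x]] sum_distrib_left aug_def[of x])

lemma aug_diff [simp]: "aug (x - y) = aug x - aug y"
  using aug_add[of "x - y" y] by simp

lemma aug_sum: "aug (\<Sum>i\<in>I. f i) = (\<Sum>i\<in>I. aug (f i))"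
  by (induction I rule: infinite_finite_induct) auto

lemma aug_lin_ext [simp]: "aug (lin_ext f x) = aug x"
  by (simp add: lin_ext_def aug_sum aug_def[of x])

text \<open>Pairs with the same image under \<open>f\<close> merge into one generator, which adds
  their coefficients and keeps the total.\<close>

lemma aug_bilin_ext [simp]: "aug (bilin_ext f x y) = aug x * aug y"
  by (simp add: bilin_ext_def aug_sum aug_def[of x] aug_def[of y] sum_product)

definition aug_series :: "'a graded \<Rightarrow> rat fps" where
  "aug_series x = Abs_fps (\<lambda>k. aug (x k))"

lemma aug_series_nth [simp]: "fps_nth (aug_series x) k = aug (x k)"
  by (simp add: aug_series_def)

lemma aug_series_graded_ext [simp]:
  "aug_series (graded_ext f x y) = aug_series x * aug_series y"
  by (rule fps_ext) (simp add: graded_ext_def aug_sum fps_mult_nth atLeast0AtMost)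

lemma aug_series_in_degree_0 [simp]: "aug_series (in_degree_0 a) = 1"
  by (rule fps_ext) (simp add: in_degree_0_def)

section \<open>Supports of formal combinations\<close>

lemma keys_sum_elim:
  assumes "a \<in> Poly_Mapping.keys (\<Sum>i\<in>I. f i)"
  obtains i where "i \<in> I" "a \<in> Poly_Mapping.keys (f i)"
  using assms Poly_Mapping.keys_sum[of f I] by auto

lemma keys_lin_ext_elim:
  assumes "b \<in> Poly_Mapping.keys (lin_ext f x)"
  obtains a where "a \<in> Poly_Mapping.keys x" "b = f a"
  using assms unfolding lin_ext_def
  by (elim keys_sum_elim) (auto dest!: subsetD[OF keys_smul])

lemma keys_graded_ext_elim:
  assumes "c \<in> Poly_Mapping.keys (graded_ext f x y k)"
  obtains i a b where "i \<le> k" "a \<in> Poly_Mapping.keys (x i)" "b \<in> Poly_Mapping.keys (y (k - i))" "c = f a b"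
  using assms unfolding graded_ext_def bilin_ext_def
  by (elim keys_sum_elim) (auto dest!: subsetD[OF keys_smul])

lemma keys_in_degree_0: "b \<in> Poly_Mapping.keys (in_degree_0 a k) \<longleftrightarrow> k = 0 \<and> b = a"
  by (simp add: in_degree_0_def)

section \<open>Degree and the 4T relation\<close>

definition degree_codes :: "nat \<Rightarrow> nat \<Rightarrow> nat list list set" where
  "degree_codes m k = {ws. is_code m ws \<and> length (concat ws) = 2 * k}"

lemma chord_diagrams_eq: "chord_diagrams m k = diagram_of_code m ` degree_codes m k"
  by (auto simp: chord_diagrams_def degree_codes_def diagram_of_code_def quotient_def)

lemma code_rel_refl:
  assumes "is_code m ws"
  shows "(ws, ws) \<in> code_rel m"
proof -
  have "\<exists>r. ws ! i = rotate r (map id (ws ! i))" for i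
    by (rule exI[of _ 0]) simp
  then show ?thesis
    using assms by (auto simp: code_rel_def intro!: exI[of _ id])
qed

lemma length_concat_nth: "length (concat ws) = (\<Sum>i<length ws. length (ws ! i))"
  by (simp add: length_concat sum_list_sum_nth atLeast0LessThan)

lemma code_rel_length:
  assumes "(vs, ws) \<in> code_rel m"
  shows "length (concat ws) = length (concat vs)"
proof -
  have "length vs = m" "length ws = m"
    using assms by (auto simp: code_rel_def is_code_def)
  moreover have "length (ws ! i) = length (vs ! i)" if "i < m" for i
    using assms that by (fastforce simp: code_rel_def)
  ultimately show ?thesis
    by (simp add: length_concat_nth)
qed

text \<open>An invalid code has the empty class. A class in \<open>chord_diagrams m k\<close>
  contains its own code \<open>vs\<close> by reflexivity, so equality of classes relates
  \<open>ws\<close> to \<open>vs\<close>, and related codes are valid and of equal length.\<close>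

lemma diagram_of_code_in_chord_diagrams_iff:
  "diagram_of_code m ws \<in> chord_diagrams m k \<longleftrightarrow> ws \<in> degree_codes m k"
proof
  assume "diagram_of_code m ws \<in> chord_diagrams m k"
  then obtain vs where vs: "vs \<in> degree_codes m k" "diagram_of_code m ws = diagram_of_code m vs"
    by (auto simp: chord_diagrams_eq)
  then have "vs \<in> diagram_of_code m ws"
    using code_rel_refl[of m vs] by (auto simp: degree_codes_def diagram_of_code_def)
  then have "(ws, vs) \<in> code_rel m"
    by (simp add: diagram_of_code_def)
  then show "ws \<in> degree_codes m k"
    using code_rel_length[of ws vs m] vs by (auto simp: degree_codes_def code_rel_def)
qed (auto simp: chord_diagrams_eq)

lemma degree_codes_cong:
  assumes "length vs = length ws" "mset (concat vs) = mset (concat ws)"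
  shows "vs \<in> degree_codes m k \<longleftrightarrow> ws \<in> degree_codes m k"
proof -
  have "count_list (concat vs) = count_list (concat ws)"
    using assms(2) by (metis count_mset ext)
  then show ?thesis
    using assms(1) mset_eq_setD[OF assms(2)] mset_eq_length[OF assms(2)]
    unfolding degree_codes_def is_code_def by (simp del: set_concat)
qed

definition degree_sum :: "nat \<Rightarrow> nat \<Rightarrow> chord_diagram lin \<Rightarrow> rat" where
  "degree_sum m k x = (\<Sum>D\<in>chord_diagrams m k. Poly_Mapping.lookup x D)"

lemma degree_sum_add: "degree_sum m k (x + y) = degree_sum m k x + degree_sum m k y"
  by (simp add: degree_sum_def lookup_add sum.distrib)

lemma degree_sum_diff: "degree_sum m k (x - y) = degree_sum m k x - degree_sum m k y"
  by (simp add: degree_sum_def lookup_minus sum_subtractf)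

lemma degree_sum_smul: "degree_sum m k (smul c x) = c * degree_sum m k x"
  by (simp add: degree_sum_def sum_distrib_left)

lemma degree_sum_gen_cong:
  assumes "mset (concat vs) = mset (concat ws)" "length vs = length ws"
  shows "degree_sum m k (gen (diagram_of_code m vs)) = degree_sum m k (gen (diagram_of_code m ws))"
\<comment> \<open>Finiteness is established only later; over an infinite set both sums are 0 by
  convention.\<close>
proof (cases "finite (chord_diagrams m k)")
  case True
  then have "degree_sum m k (gen (diagram_of_code m us)) = (if us \<in> degree_codes m k then 1 else 0)" for us
    by (simp add: degree_sum_def lookup_single when_def
        flip: diagram_of_code_in_chord_diagrams_iff)
  then show ?thesis
    using degree_codes_cong[OF assms(2,1)] by simp
qed (simp add: degree_sum_def)

lemma mset_subst_letters: "mset (subst_letters \<sigma> w) = (\<Sum>x\<in>#mset w. mset (\<sigma> x))"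
  by (induction w) (simp_all add: subst_letters_def)

lemma mset_concat_subst_letters:
  assumes "\<And>x. mset (\<sigma> x) = mset (\<tau> x)"
  shows "mset (concat (map (subst_letters \<sigma>) ws)) = mset (concat (map (subst_letters \<tau>) ws))"
  using assms by (induction ws) (simp_all add: mset_subst_letters)

lemma degree_sum_fill_arcs_cong:
  assumes "mset u = mset u'" "mset v = mset v'" "mset w = mset w'"
  shows "degree_sum m k (gen (diagram_of_code m (fill_arcs p q r ws u v w)))
       = degree_sum m k (gen (diagram_of_code m (fill_arcs p q r ws u' v' w')))"
  unfolding fill_arcs_def using assms
  by (intro degree_sum_gen_cong mset_concat_subst_letters) auto

text \<open>The first two terms differ only in the order of \<open>a\<close> and \<open>b\<close> on
  the arc \<open>p\<close>, the last two only in their order on \<open>q\<close>; each pair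
  cancels.\<close>

lemma degree_sum_relator:
  assumes "x \<in> relators_4T m"
  shows "degree_sum m k x = 0"
proof -
  obtain p q r ws a b where x: "x = gen (diagram_of_code m (fill_arcs p q r ws [a, b] [a] [b]))
      - gen (diagram_of_code m (fill_arcs p q r ws [b, a] [a] [b]))
      + gen (diagram_of_code m (fill_arcs p q r ws [a] [a, b] [b]))
      - gen (diagram_of_code m (fill_arcs p q r ws [a] [b, a] [b]))"
    using assms by (auto simp: relators_4T_def)
  show ?thesis
    unfolding x degree_sum_add degree_sum_diff
    using degree_sum_fill_arcs_cong[of "[a, b]" "[b, a]" "[a]" "[a]" "[b]" "[b]" m k p q r ws]
      degree_sum_fill_arcs_cong[of "[a]" "[a]" "[a, b]" "[b, a]" "[b]" "[b]" m k p q r ws]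
    by simp
qed

lemma degree_sum_span:
  assumes "x \<in> lin_span (relators_4T m)"
  shows "degree_sum m k x = 0"
  using assms
proof (induction rule: lin.span_induct_alt)
  case base
  then show ?case by (simp add: degree_sum_def)
next
  case (step c x y)
  then show ?case by (simp add: degree_sum_add degree_sum_smul degree_sum_relator)
qed

lemma degree_sum_class_A:
  assumes "y \<in> class_A m z"
  shows "degree_sum m k (y k) = degree_sum m k (z k)"
  using assms degree_sum_span[of "y k - z k" m k] by (simp add: class_A_def degree_sum_diff)

section \<open>Renaming chords, and finiteness of the set of diagrams of a given degree\<close>

lemma is_code_map:
  assumes "inj_on f (set (concat ws))" "is_code m ws"
  shows "is_code m (map (map f) ws)"
proof -
  have "count_list (concat (map (map f) ws)) (f x) = count_list (concat ws) x" if "x \<in> set (concat ws)" for x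
    using that assms(1) count_list_inj_map[of f "concat ws" x]
    by (simp flip: map_concat)
  moreover have "set (concat (map (map f) ws)) = f ` set (concat ws)"
    by auto
  ultimately show ?thesis
    using assms(2) by (simp add: is_code_def del: set_concat)
qed

text \<open>A renaming witnessing one relation is composed with \<open>f\<close>, or with its
  inverse on the letters of \<open>vs\<close>, to witness the other. This allows chord names to be
  normalised.\<close>

lemma code_rel_map:
  assumes f: "inj_on f (set (concat vs))" and vs: "is_code m vs"
  shows "code_rel m `` {map (map f) vs} = code_rel m `` {vs}"
proof -
  let ?vs = "map (map f) vs"
  have len: "length vs = m"
    using vs by (simp add: is_code_def)
  have code: "is_code m ?vs"
    using f vs by (rule is_code_map)
  have set: "set (concat ?vs) = f ` set (concat vs)"
    by auto
  have sub: "set (vs ! i) \<subseteq> set (concat vs)" if "i < m" for i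
    using that len by (auto intro!: bexI[of _ "vs ! i"])
  show ?thesis
  proof (intro subset_antisym subsetI)
    fix us assume "us \<in> code_rel m `` {?vs}"
    then have "is_code m us \<and> (\<exists>g. inj_on g (f ` set (concat vs))
      \<and> (\<forall>i<m. \<exists>r. us ! i = rotate r (map g (?vs ! i))))"
      by (simp add: code_rel_def flip: set del: set_concat)
    then obtain g where us: "is_code m us" and g: "inj_on g (f ` set (concat vs))"
      and rot: "\<forall>i<m. \<exists>r. us ! i = rotate r (map g (?vs ! i))"
      by (elim conjE exE)
    have "inj_on (g \<circ> f) (set (concat vs))"
      using f g by (rule comp_inj_on)
    moreover have "\<exists>r. us ! i = rotate r (map (g \<circ> f) (vs ! i))" if "i < m" for i
      using rot that len by simp
    ultimately have "\<exists>h. inj_on h (set (concat vs)) \<and> (\<forall>i<m. \<exists>r. us ! i = rotate r (map h (vs ! i)))"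
      by (intro exI[of _ "g \<circ> f"]) simp
    then show "us \<in> code_rel m `` {vs}"
      using us vs by (simp add: code_rel_def del: set_concat)
  next
    fix us assume "us \<in> code_rel m `` {vs}"
    then have "is_code m us \<and> (\<exists>g. inj_on g (set (concat vs))
      \<and> (\<forall>i<m. \<exists>r. us ! i = rotate r (map g (vs ! i))))"
      by (simp add: code_rel_def del: set_concat)
    then obtain g where us: "is_code m us" and g: "inj_on g (set (concat vs))"
      and rot: "\<forall>i<m. \<exists>r. us ! i = rotate r (map g (vs ! i))"
      by (elim conjE exE)
    let ?h = "g \<circ> inv_into (set (concat vs)) f"
    have "inj_on ?h (f ` set (concat vs))"
      using g f by (intro comp_inj_on inj_on_inv_into order.refl) (simp add: inv_into_image_cancel)
    moreover have "map ?h (?vs ! i) = map g (vs ! i)" if "i < m" for i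
      using sub[OF that] that len f by (auto simp del: set_concat)
    then have "\<forall>i<m. \<exists>r. us ! i = rotate r (map ?h (?vs ! i))"
      using rot by simp
    ultimately have "\<exists>h. inj_on h (set (concat ?vs)) \<and> (\<forall>i<m. \<exists>r. us ! i = rotate r (map h (?vs ! i)))"
      unfolding set by (intro exI[of _ ?h] conjI)
    then show "us \<in> code_rel m `` {?vs}"
      using us code by (simp add: code_rel_def del: set_concat)
  qed
qed

text \<open>Arbitrary chord names make the set of codes infinite, but a code of degree k has at most
  2k names, so each class has a representative with names below 2k. Without finiteness the sum in
  the theorem would be 0 by convention.\<close>

lemma finite_chord_diagrams: "finite (chord_diagrams m k)"
proof (rule finite_subset)
  let ?W = "{ws. set ws \<subseteq> {w. set w \<subseteq> {..<2 * k} \<and> length w \<le> 2 * k} \<and> length ws = m}"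
  show "finite (diagram_of_code m ` ?W)"
    by (intro finite_imageI finite_lists_length_eq finite_lists_length_le) simp
  show "chord_diagrams m k \<subseteq> diagram_of_code m ` ?W"
  proof
    fix D assume "D \<in> chord_diagrams m k"
    then obtain vs where vs: "is_code m vs" "length (concat vs) = 2 * k" "D = diagram_of_code m vs"
      by (auto simp: chord_diagrams_eq degree_codes_def)
    have "card (set (concat vs)) \<le> card {..<2 * k}"
      using card_length[of "concat vs"] vs(2) by simp
    then obtain f where f: "f ` set (concat vs) \<subseteq> {..<2 * k}" "inj_on f (set (concat vs))"
      using card_le_inj[of "set (concat vs)" "{..<2 * k}"] by auto
    have "length w \<le> 2 * k" if "w \<in> set vs" for w
      using that vs(2) member_le_sum_list[of "length w" "map length vs"]
      by (auto simp: length_concat)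
    moreover have "f x < 2 * k" if "w \<in> set vs" "x \<in> set w" for w x
      using f(1) that by fastforce
    ultimately have "map (map f) vs \<in> ?W"
      using vs(1) by (auto simp: is_code_def)
    moreover have "D = diagram_of_code m (map (map f) vs)"
      unfolding vs(3) diagram_of_code_def using code_rel_map[OF f(2) vs(1)] by simp
    ultimately show "D \<in> diagram_of_code m ` ?W"
      by blast
  qed
qed

lemma degree_sum_eq_aug:
  assumes "Poly_Mapping.keys x \<subseteq> chord_diagrams m k"
  shows "degree_sum m k x = aug x"
  using assms by (simp add: degree_sum_def aug_superset[OF finite_chord_diagrams])

section \<open>The unknot\<close>

text \<open>The condition of \<open>is_code\<close> in degree k with the positions forgotten, since
  gluing and closing up only move endpoints around.\<close>

definition paired :: "nat \<Rightarrow> nat multiset \<Rightarrow> bool" where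
  "paired k M \<longleftrightarrow> (\<forall>x\<in>#M. count M x = 2) \<and> size M = 2 * k"

lemma inj_even_name: "inj even_name" and inj_odd_name: "inj odd_name"
  by (auto simp: inj_def even_name_def odd_name_def)

lemma even_name_neq_odd_name: "even_name x \<noteq> odd_name y"
  unfolding even_name_def odd_name_def by presburger

lemma count_image_mset_inj:
  assumes "inj f"
  shows "count (image_mset f M) (f x) = count M x"
  using assms by (induction M) (auto simp: inj_eq)

lemma count_image_mset_disjoint:
  assumes "\<And>x. f x \<noteq> y"
  shows "count (image_mset f M) y = 0"
  using assms by (auto simp: count_eq_zero_iff)

text \<open>Even and odd names never coincide, so each factor keeps its multiplicities.\<close>

lemma paired_rename:
  assumes "paired i M" "paired j N"
  shows "paired (i + j) (image_mset even_name M + image_mset odd_name N)"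
proof -
  have "count (image_mset even_name M + image_mset odd_name N) (even_name x) = count M x" for x
    using count_image_mset_inj[OF inj_even_name] count_image_mset_disjoint[of odd_name]
    by (metis add.right_neutral count_union even_name_neq_odd_name)
  moreover have "count (image_mset even_name M + image_mset odd_name N) (odd_name x) = count N x" for x
    using count_image_mset_inj[OF inj_odd_name] count_image_mset_disjoint[of even_name]
    by (metis add.left_neutral count_union even_name_neq_odd_name)
  ultimately show ?thesis
    using assms by (auto simp: paired_def)
qed

text \<open>The augmentation depends on the remaining vertices only, so the two terms of an STU step
  cancel as soon as there is a vertex.\<close>

lemma aug_stu_resolve [simp]: "aug (stu_resolve w vs) = (if vs = [] then 1 else 0)"
  by (induction w vs rule: stu_resolve.induct) auto

text \<open>The ends of edges at trivalent vertices. Added to the letters of the word, which are the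
  ends on the interval, this counts all ends of each edge.\<close>

definition edge_ends :: "(nat \<times> nat \<times> nat) list \<Rightarrow> nat multiset" where
  "edge_ends vs = (\<Sum>(l, e, f)\<leftarrow>vs. {#l, e, f#})"

lemma edge_ends_simps [simp]:
  "edge_ends [] = {#}"
  "edge_ends ((l, e, f) # vs) = {#l, e, f#} + edge_ends vs"
  "edge_ends (vs @ vs') = edge_ends vs + edge_ends vs'"
  by (simp_all add: edge_ends_def)

lemma legs_subset_edge_ends: "mset (map fst vs) \<subseteq># edge_ends vs"
proof (induction vs)
  case (Cons v vs)
  obtain l e f where "v = (l, e, f)" by (cases v)
  then show ?case
    using subset_mset.add_mono[OF Cons empty_le[of "{#f, e#}"]] by simp
qed simp

lemma subst_letters_id: "l \<notin> set w \<Longrightarrow> subst_letters ((\<lambda>x. [x])(l := s)) w = w"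
  by (induction w) (auto simp: subst_letters_def)

lemma mset_subst_letters_once:
  assumes "count (mset w) l = 1"
  shows "mset (subst_letters ((\<lambda>x. [x])(l := s)) w) = mset w - {#l#} + mset s"
proof -
  have "l \<in> set w"
    using assms by (metis count_mset_0_iff zero_neq_one)
  then obtain a b where w: "w = a @ l # b"
    by (metis split_list)
  then have "l \<notin> set a" "l \<notin> set b"
    using assms by (auto simp: count_mset_0_iff)
  then show ?thesis
    using subst_letters_id[of l a s] subst_letters_id[of l b s]
    by (simp add: w) (simp add: subst_letters_def)
qed

text \<open>The hypotheses are an invariant: every edge has two ends in all, and a leg yet to be
  resolved has one of them on the interval. A step removes both ends of the leg \<open>l\<close> and
  moves one end each of \<open>e\<close> and \<open>f\<close> to the interval, which lengthens the
  word by one. When no vertex is left, all edges are chords.\<close>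

lemma keys_stu_resolve:
  assumes "u \<in> Poly_Mapping.keys (stu_resolve w vs)"
    and "\<And>x. x \<in># mset w + edge_ends vs \<Longrightarrow> count (mset w + edge_ends vs) x = 2"
    and "\<And>l. l \<in> fst ` set vs \<Longrightarrow> count (mset w) l = 1"
  shows "(\<forall>x\<in>set u. count (mset u) x = 2) \<and> length u = length w + length vs"
  using assms
proof (induction vs arbitrary: w)
  case Nil
  then show ?case by simp
next
  case (Cons v vs)
  obtain l e f where v: "v = (l, e, f)" by (cases v)
  define N where "N = mset w - {#l#}"
  have "count (mset w) l = 1"
    using Cons.prems(3) v by simp
  then have "l \<in># mset w"
    by (metis not_in_iff zero_neq_one)
  with \<open>count (mset w) l = 1\<close> have N: "mset w = add_mset l N" "count N l = 0"
    by (simp_all add: N_def not_in_iff)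
  obtain s where s: "s = [e, f] \<or> s = [f, e]"
    and u: "u \<in> Poly_Mapping.keys (stu_resolve (subst_letters ((\<lambda>x. [x])(l := s)) w) vs)"
    using Cons.prems(1) v by (auto dest!: subsetD[OF keys_diff])
  let ?w = "subst_letters ((\<lambda>x. [x])(l := s)) w"
  have w': "mset ?w = N + {#e, f#}"
    using mset_subst_letters_once[OF \<open>count (mset w) l = 1\<close>] s by (auto simp: N_def)
  have two: "count (mset w + edge_ends (v # vs)) x = 2" if "x \<in># mset w + edge_ends (v # vs)" for x
    using Cons.prems(2) that .
  \<comment> \<open>The letter in \<open>w\<close> and the first entry of \<open>v\<close> already
    are the two ends of \<open>l\<close>.\<close>
  have "count (edge_ends vs) l = 0" "e \<noteq> l" "f \<noteq> l"
    using two[of l] v N by (auto split: if_splits)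
  have IH1: "count (mset ?w + edge_ends vs) x = 2" if "x \<in># mset ?w + edge_ends vs" for x
  proof -
    have "x \<noteq> l"
      using that N \<open>count (edge_ends vs) l = 0\<close> \<open>e \<noteq> l\<close> \<open>f \<noteq> l\<close> unfolding w'
      by (auto simp: not_in_iff[symmetric])
    then show ?thesis
      using two[of x] that v N unfolding w' by auto
  qed
  \<comment> \<open>One end of \<open>l'\<close> is in \<open>w\<close> and the other at a later
    vertex, so \<open>l'\<close> is neither \<open>e\<close> nor \<open>f\<close> and gains no
    letter.\<close>
  have IH2: "count (mset ?w) l' = 1" if "l' \<in> fst ` set vs" for l'
  proof -
    have *: "l' \<in># edge_ends vs"
      using that legs_subset_edge_ends[of vs] by (metis list.set_map mset_subset_eqD set_mset_mset)
    then have "l' \<noteq> l"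
      using \<open>count (edge_ends vs) l = 0\<close> by (metis not_in_iff)
    moreover have "count (mset w) l' = 1"
      using Cons.prems(3) that by simp
    moreover have "count (edge_ends vs) l' > 0"
      using * by simp
    ultimately show ?thesis
      using two[of l'] * v N unfolding w' by (auto split: if_splits simp del: count_greater_zero_iff)
  qed
  have "length ?w = Suc (length w)"
    using arg_cong[OF w', of size] arg_cong[OF N(1), of size] by simp
  then show ?case
    using Cons.IH[OF u IH1 IH2] by simp
qed

lemma mset_map_Suc_mod: "mset (map (\<lambda>i. Suc i mod n) [0..<n]) = mset [0..<n]"
proof (cases n)
  case (Suc k)
  have "map (\<lambda>i. Suc i mod n) [0..<n] = map Suc [0..<k] @ [0]"
    by (simp add: Suc)
  then show ?thesis
    by (simp add: map_Suc_upt Suc upt_conv_Cons del: upt_Suc)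
qed simp

text \<open>A leg ends on the interval and at its vertex; a rim edge is the second entry of one
  vertex and the third entry of the cyclically preceding one.\<close>

lemma mset_wheel:
  "mset (map fst (wheel c n)) + edge_ends (wheel c n) = mset [c..<c + 2 * n] + mset [c..<c + 2 * n]"
proof -
  have "map ((+) d) [0..<n] = [d..<d + n]" for d
    by (induction n) simp_all
  then have "[c..<c + 2 * n] = map ((+) c) [0..<n] @ map ((+) (c + n)) [0..<n]"
    using upt_add_eq_append[of c "c + n" n] by (simp add: mult_2 add.assoc)
  then have split: "mset [c..<c + 2 * n] = mset (map ((+) c) [0..<n]) + mset (map ((+) (c + n)) [0..<n])"
    by (simp only: mset_append)
  have "mset (map ((+) (c + n)) (map (\<lambda>i. Suc i mod n) [0..<n])) = mset (map ((+) (c + n)) [0..<n])"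
    using mset_map_Suc_mod[of n] by (simp only: mset_map)
  moreover have "edge_ends (map (\<lambda>i. (g i, h i, k i)) is) = mset (map g is) + mset (map h is) + mset (map k is)"
    for g h k :: "nat \<Rightarrow> nat" and "is"
    by (induction "is") auto
  ultimately show ?thesis
    unfolding split by (simp add: wheel_def comp_def)
qed

lemma mset_wheels:
  "mset (map fst (wheels c ns)) + edge_ends (wheels c ns)
    = mset [c..<c + 2 * sum_list ns] + mset [c..<c + 2 * sum_list ns]"
proof (induction ns arbitrary: c)
  case (Cons n ns)
  have "mset [c..<c + 2 * sum_list (n # ns)] = mset [c..<c + 2 * n] + mset [c + 2 * n..<c + 2 * n + 2 * sum_list ns]"
    using upt_add_eq_append[of c "c + 2 * n" "2 * sum_list ns"]
    by (simp add: add.assoc distrib_left del: mset_upt flip: mset_append)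
  then show ?case
    using Cons.IH[of "c + 2 * n"] mset_wheel[of c n] by (simp add: ac_simps del: mset_upt)
qed simp

lemma count_mset_distinct: "distinct xs \<Longrightarrow> count (mset xs) x = (if x \<in> set xs then 1 else 0)"
  by (simp add: distinct_count_atmost_1)

text \<open>Each occurrence of a name as a leg also counts among the edge ends, and the two counts
  together are at most 2.\<close>

lemma distinct_legs_wheels: "distinct (map fst (wheels c ns))"
proof -
  let ?vs = "wheels c ns"
  have "count (mset (map fst ?vs)) l \<le> 1" for l
  proof -
    have "count (mset (map fst ?vs)) l \<le> count (edge_ends ?vs) l"
      using legs_subset_edge_ends by (rule mset_subset_eq_count)
    moreover have "count (mset (map fst ?vs)) l + count (edge_ends ?vs) l \<le> 2"
      unfolding count_union[symmetric] mset_wheels by (simp add: count_mset_distinct del: mset_upt)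
    ultimately show ?thesis by linarith
  qed
  then show ?thesis
    by (metis One_nat_def count_mset_0_iff distinct_count_atmost_1 le_SucE le_zero_eq)
qed

lemma length_wheels: "length (wheels c ns) = sum_list ns"
  by (induction ns arbitrary: c) (simp_all add: wheel_def)

text \<open>A wheel has as many vertices as legs and each STU step adds one endpoint, so n legs end
  up as 2n endpoints, that is, n chords.\<close>

lemma keys_chi_wheels:
  assumes "u \<in> Poly_Mapping.keys (chi (wheels c ns))"
  shows "paired (sum_list ns) (mset u)"
proof -
  let ?vs = "wheels c ns"
  obtain w where w: "w \<in> permutations_of_set (set (map fst ?vs))"
    and u: "u \<in> Poly_Mapping.keys (stu_resolve w ?vs)"
    using assms unfolding chi_def by (auto dest!: subsetD[OF keys_smul] elim: keys_sum_elim)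
  have mset_w: "mset w = mset (map fst ?vs)"
    using w distinct_legs_wheels[of c ns]
    by (intro set_eq_iff_mset_eq_distinct[THEN iffD1]) (auto simp: permutations_of_set_def)
  have M: "mset w + edge_ends ?vs = mset [c..<c + 2 * sum_list ns] + mset [c..<c + 2 * sum_list ns]"
    unfolding mset_w by (rule mset_wheels)
  have "(\<forall>x\<in>set u. count (mset u) x = 2) \<and> length u = length w + length ?vs"
  proof (rule keys_stu_resolve[OF u])
    show "count (mset w + edge_ends ?vs) x = 2" if "x \<in># mset w + edge_ends ?vs" for x
      using that unfolding M by (simp add: count_mset_distinct del: mset_upt)
    show "count (mset w) l = 1" if "l \<in> fst ` set ?vs" for l
      using that distinct_legs_wheels[of c ns] unfolding mset_w by (simp add: count_mset_distinct del: mset_map)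
  qed
  moreover have "length w = length ?vs"
    using arg_cong[OF mset_w, of size] by simp
  ultimately show ?thesis
    by (simp add: paired_def length_wheels)
qed

lemma keys_nu:
  assumes "u \<in> Poly_Mapping.keys (nu k)"
  shows "paired k (mset u)"
proof -
  obtain ns where "2 * sum_list ns = k" "u \<in> Poly_Mapping.keys (chi (wheels 0 (map ((*) 2) ns)))"
    using assms unfolding nu_def by (auto dest!: subsetD[OF keys_smul] elim: keys_sum_elim)
  then show ?thesis
    using keys_chi_wheels[of u 0 "map ((*) 2) ns"] by (simp add: sum_list_const_mult)
qed

lemma aug_nu: "aug_series nu = 1"
proof (rule fps_ext)
  fix k :: nat
  let ?N = "{ns. 0 \<notin> set ns \<and> 2 * sum_list ns = k}"
  have chi: "aug (chi (wheels 0 (map ((*) 2) ns))) = (if ns = [] then 1 else 0)" if "0 \<notin> set ns" for ns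
  proof (cases ns)
    case Nil
    then show ?thesis by (simp add: chi_def)
  next
    case (Cons n ns')
    \<comment> \<open>A wheel with 0 legs would have no vertex and augmentation 1; this is where the
      entries of \<open>ns\<close> must be positive.\<close>
    then have "wheels 0 (map ((*) 2) ns) \<noteq> []"
      using that by (simp add: wheel_def)
    then show ?thesis
      using Cons by (simp add: chi_def aug_sum)
  qed
  show "fps_nth (aug_series nu) k = fps_nth 1 k"
  proof (cases "k = 0")
    case True
    have "ns = []" if "0 \<notin> set ns" "sum_list ns = 0" for ns :: "nat list"
      using that by (cases ns) auto
    then have "?N = {[]}"
      using True by auto
    then show ?thesis
      using chi[of "[]"] True by (simp add: nu_def)
  next
    case False
    then have "aug (nu k) = (\<Sum>ns\<in>?N. 0)"
      unfolding nu_def aug_sum by (intro sum.cong refl) (use chi in auto)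
    then show ?thesis
      using False by simp
  qed
qed

lemma aug_word_power: "aug_series (word_power x n) = aug_series x ^ n"
  by (induction n) (simp_all add: word_mult_def)

text \<open>The series of \<open>nu\<close> minus 1 has augmentation 0, so only the power with
  exponent 0 contributes to the binomial series.\<close>

lemma aug_sqrt_nu: "aug_series sqrt_nu = 1"
proof (rule fps_ext)
  fix k
  have "aug_series (\<lambda>d. nu d - in_degree_0 [] d) = aug_series nu - aug_series (in_degree_0 ([] :: nat list))"
    by (rule fps_ext) (simp del: aug_series_in_degree_0)
  then have *: "aug (word_power (\<lambda>d. nu d - in_degree_0 [] d) n j) = (if n = 0 \<and> j = 0 then 1 else 0)" for n j
    by (simp add: aug_nu aug_word_power power_0_left flip: aug_series_nth)
  have "aug (sqrt_nu k) = (\<Sum>n\<le>k. if n = 0 then (if k = 0 then 1 else 0) else 0)"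
    unfolding sqrt_nu_def aug_sum by (intro sum.cong refl) (simp add: *)
  then show "fps_nth (aug_series sqrt_nu) k = fps_nth 1 k"
    by simp
qed

lemma keys_word_power:
  assumes "\<And>d u. u \<in> Poly_Mapping.keys (x d) \<Longrightarrow> paired d (mset u)"
    and "u \<in> Poly_Mapping.keys (word_power x n k)"
  shows "paired k (mset u)"
  using assms(2)
proof (induction n arbitrary: k u)
  case 0
  then show ?case by (simp add: keys_in_degree_0 paired_def)
next
  case (Suc n)
  then obtain i v w where "i \<le> k" "v \<in> Poly_Mapping.keys (x i)"
    "w \<in> Poly_Mapping.keys (word_power x n (k - i))" "u = map even_name v @ map odd_name w"
    unfolding word_power.simps word_mult_def by (elim keys_graded_ext_elim)
  then show ?case
    using paired_rename[of i "mset v" "k - i" "mset w"] assms(1) Suc.IH by simp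
qed

lemma keys_sqrt_nu:
  assumes "u \<in> Poly_Mapping.keys (sqrt_nu k)"
  shows "paired k (mset u)"
proof -
  obtain n where "u \<in> Poly_Mapping.keys (word_power (\<lambda>d. nu d - in_degree_0 [] d) n k)"
    using assms unfolding sqrt_nu_def by (auto dest!: subsetD[OF keys_smul] elim: keys_sum_elim)
  moreover have "paired d (mset v)" if "v \<in> Poly_Mapping.keys (nu d - in_degree_0 [] d)" for d v
    using that subsetD[OF keys_diff] keys_nu
    by (fastforce simp: keys_in_degree_0 paired_def)
  ultimately show ?thesis
    using keys_word_power[of "\<lambda>d. nu d - in_degree_0 [] d" u n k] by simp
qed

section \<open>Associators\<close>

text \<open>Every relator is a combination of words with at least two letters, so linear
  coefficients are well defined in the quotient.\<close>

lemma lookup_singleton_dk_relator: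
  assumes "x \<in> lin_span (dk_relators n)"
  shows "Poly_Mapping.lookup x [t] = 0"
  using assms
proof (induction rule: lin.span_induct_alt)
  case (step c x y)
  then show ?case
    by (auto simp: dk_relators_def dk_commutator_def lookup_add lookup_minus lookup_single when_def)
qed simp

lemma dk_eq_singleton:
  assumes "dk_eq n f g" "t \<in> dk_gens n"
  shows "f [t] = g [t]"
proof -
  let ?W = "{w. length w = 1 \<and> set w \<subseteq> dk_gens n}"
  have "dk_gens n \<subseteq> Pow {1..n}"
    by (auto simp: dk_gens_def)
  then have "finite (dk_gens n)"
    by (rule finite_subset) simp
  then have "finite ?W"
    using finite_lists_length_eq[of "dk_gens n" 1] by (simp add: conj_commute)
  moreover have "[t] \<in> ?W"
    using assms(2) by simp
  ultimately have "(\<Sum>w\<in>?W. if w = [t] then f w - g w else 0) = f [t] - g [t]"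
    by (subst sum.delta) auto
  moreover have "Poly_Mapping.lookup (\<Sum>w\<in>?W. smul (f w - g w) (gen w)) [t]
      = (\<Sum>w\<in>?W. if w = [t] then f w - g w else 0)"
    unfolding lookup_sum by (intro sum.cong refl) (simp add: lookup_single when_def)
  moreover have "(\<Sum>w\<in>?W. smul (f w - g w) (gen w)) \<in> lin_span (dk_relators n)"
    using assms(1) unfolding dk_eq_def by (rule spec)
  ultimately show ?thesis
    using lookup_singleton_dk_relator[of _ n t] by simp
qed

lemma nc_mult_Nil [simp]: "(f \<odot> g) [] = f [] * g []"
  by (simp add: nc_mult_def)

lemma nc_mult_singleton [simp]: "(f \<odot> g) [t] = f [] * g [t] + f [t] * g []"
  by (simp add: nc_mult_def atMost_Suc)

lemma drinfeld_associator_linear: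
  assumes "drinfeld_associator \<Phi>"
  shows "\<Phi> [b] = 0"
proof -
  define P :: "nat set set \<Rightarrow> nat set set \<Rightarrow> nat set ncseries" where "P = subst2 \<Phi>"
  define t :: "nat \<Rightarrow> nat \<Rightarrow> nat set set" where "t i j = {{i, j}}" for i j
  have one: "\<Phi> [] = 1"
    using assms by (simp add: drinfeld_associator_def group_like_def Let_def)
  have pentagon: "dk_eq 4 (P (t 1 3 \<union> t 2 3) (t 3 4) \<odot> P (t 1 2) (t 2 3 \<union> t 2 4))
      (P (t 1 2) (t 2 3) \<odot> P (t 1 2 \<union> t 1 3) (t 2 4 \<union> t 3 4) \<odot> P (t 2 3) (t 3 4))"
    using assms unfolding drinfeld_associator_def Let_def P_def t_def by (elim conjE)
  have "{i, j} \<in> dk_gens 4" if "i \<in> {1..4}" "j \<in> {1..4}" "i \<noteq> j" for i j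
    using that by (auto simp: dk_gens_def)
  from this[of 1 2] this[of 3 4] have "{1, 2} \<in> dk_gens 4" "{3, 4} \<in> dk_gens 4"
    by simp_all
  \<comment> \<open>comparing the coefficients of \<open>t\<^sub>1\<^sub>2\<close> and \<open>t\<^sub>3\<^sub>4\<close> gives \<open>\<Phi> [b] = 2 \<Phi> [b]\<close>\<close>
  from this[THEN dk_eq_singleton[OF pentagon]]
  have "\<Phi> [True] = 0" "\<Phi> [False] = 0"
    by (simp_all add: P_def t_def subst2_def one doubleton_eq_iff)
  then show ?thesis
    by (cases b) simp_all
qed

section \<open>Sums over words with commuting weights\<close>

lemma sum_lists_Suc:
  assumes "finite H"
  shows "(\<Sum>hs | length hs = Suc k \<and> set hs \<subseteq> H. G hs)
       = (\<Sum>h\<in>H. \<Sum>hs | length hs = k \<and> set hs \<subseteq> H. G (h # hs))"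
proof -
  let ?L = "\<lambda>k. {hs. length hs = k \<and> set hs \<subseteq> H}"
  have "(\<Sum>hs\<in>?L (Suc k). G hs) = (\<Sum>(h, hs)\<in>H \<times> ?L k. G (h # hs))"
    by (rule sum.reindex_bij_witness[where j = "\<lambda>hs. (hd hs, tl hs)" and i = "\<lambda>(h, hs). h # hs"])
      (auto simp: length_Suc_conv)
  also have "\<dots> = (\<Sum>h\<in>H. \<Sum>hs\<in>?L k. G (h # hs))"
    by (simp add: sum.cartesian_product)
  finally show ?thesis .
qed

text \<open>Cabling replaces each of the two generators of the associator by a sum of chords. Under
  the augmentation this amounts to replacing it by a scalar, the total weight of the chords of its
  type.\<close>

lemma sum_lists_by_type:
  fixes F :: "bool list \<Rightarrow> rat"
  assumes "finite H"
  shows "(\<Sum>hs | length hs = k \<and> set hs \<subseteq> H. F (map c hs) * (\<Prod>h\<leftarrow>hs. d h))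
       = (\<Sum>w | length w = k. F w * (\<Prod>b\<leftarrow>w. \<Sum>h | h \<in> H \<and> c h = b. d h))"
proof (induction k arbitrary: F)
  case 0
  have "{hs. hs = [] \<and> set hs \<subseteq> H} = {[]}"
    by auto
  then show ?case by simp
next
  case (Suc k)
  define \<gamma> where "\<gamma> b = (\<Sum>h | h \<in> H \<and> c h = b. d h)" for b
  define T where "T b = (\<Sum>w | length w = k. F (b # w) * (\<Prod>b\<leftarrow>w. \<gamma> b))" for b
  have "(\<Sum>hs | length hs = Suc k \<and> set hs \<subseteq> H. F (map c hs) * (\<Prod>h\<leftarrow>hs. d h))
      = (\<Sum>h\<in>H. d h * (\<Sum>hs | length hs = k \<and> set hs \<subseteq> H. F (c h # map c hs) * (\<Prod>h\<leftarrow>hs. d h)))"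
    by (simp add: sum_lists_Suc[OF assms] sum_distrib_left algebra_simps)
  also have "\<dots> = (\<Sum>h\<in>H. d h * T (c h))"
    by (simp add: Suc.IH[where F = "\<lambda>w. F (_ # w)"] T_def \<gamma>_def)
  also have "\<dots> = (\<Sum>b\<in>UNIV. \<Sum>h | h \<in> H \<and> c h = b. d h * T (c h))"
    using assms by (intro sum.group[symmetric]) auto
  also have "\<dots> = (\<Sum>b\<in>UNIV. \<gamma> b * T b)"
    by (simp add: \<gamma>_def sum_distrib_right)
  also have "\<dots> = (\<Sum>w | length w = Suc k. F w * (\<Prod>b\<leftarrow>w. \<gamma> b))"
    using sum_lists_Suc[of "UNIV :: bool set" "\<lambda>w. F w * (\<Prod>b\<leftarrow>w. \<gamma> b)" k]
    by (simp add: T_def sum_distrib_left algebra_simps)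
  finally show ?case
    by (simp only: \<gamma>_def)
qed

lemma prod_list_nths_complement:
  fixes g :: "'a \<Rightarrow> rat"
  shows "(\<Prod>b\<leftarrow>nths w I. g b) * (\<Prod>b\<leftarrow>nths w ({..<length w} - I). g b) = (\<Prod>b\<leftarrow>w. g b)"
proof (induction w arbitrary: I)
  case (Cons x w)
  have "{j. Suc j \<in> {..<Suc (length w)} - I} = {..<length w} - {j. Suc j \<in> I}"
    by auto
  then show ?case
    using Cons[of "{j. Suc j \<in> I}"] by (simp add: nths_Cons mult_ac)
qed simp

text \<open>Multiplying \<open>\<Phi> [x] = 0\<close> by \<open>\<Phi> v\<close>, group-likeness makes the sum of \<open>\<Phi>\<close> over all insertions
  of \<open>x\<close> into \<open>v\<close> vanish. Weighted and summed over \<open>x\<close> and \<open>v\<close>, every word of length \<open>k\<close>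
  arises \<open>k\<close> times.\<close>

lemma group_like_abelianization:
  assumes "group_like \<Phi>" and linear: "\<And>b. \<Phi> [b] = 0" and "0 < k"
  shows "(\<Sum>w | length w = k. \<Phi> w * (\<Prod>b\<leftarrow>w. g b)) = 0"
proof -
  define wt where "wt w = (\<Prod>b\<leftarrow>w. g b)" for w :: "bool list"
  define W where "W = {w :: bool list. length w = k}"
  \<comment> \<open>Words with one marked position. The map \<open>\<pi>\<close> splits off the
    marked letter, and its fibres are the index sets of \<open>group_like\<close> for
    \<open>u\<close> of length 1.\<close>
  define S where "S = Sigma W (\<lambda>w. {I. I \<subseteq> {..<k} \<and> card I = 1})"
  define \<pi> where "\<pi> = (\<lambda>(w :: bool list, I). (nths w I, nths w ({..<length w} - I)))"
  define T where "T = {u :: bool list. length u = 1} \<times> {v :: bool list. length v = k - 1}"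
  have fin: "finite {w :: bool list. length w = n}" for n
    using finite_lists_length_eq[of "UNIV :: bool set" n] by simp
  have "finite S" "finite T"
    unfolding S_def T_def W_def using fin
    by (auto intro: finite_subset[of _ "Pow {..<k}"])
  have len: "length (nths w I) = card I" if "I \<subseteq> {..<length w}" for w :: "bool list" and I
    using that unfolding length_nths by (intro arg_cong[where f = card]) auto
  have "\<pi> ` S \<subseteq> T"
    by (auto simp: \<pi>_def S_def T_def W_def len card_Diff_subset finite_subset)
  \<comment> \<open>A word of length k has k possible marked positions.\<close>
  have "of_nat k * (\<Sum>w\<in>W. \<Phi> w * wt w) = (\<Sum>(w, I)\<in>S. \<Phi> w * wt w)"
    using n_subsets[of "{..<k}" 1] fin
    by (simp add: S_def W_def sum_distrib_left flip: sum.Sigma)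
  also have "\<dots> = (\<Sum>y\<in>T. \<Sum>(w, I) | (w, I) \<in> S \<and> \<pi> (w, I) = y. \<Phi> w * wt w)"
    using sum.group[OF \<open>finite S\<close> \<open>finite T\<close> \<open>\<pi> ` S \<subseteq> T\<close>, of "\<lambda>(w, I). \<Phi> w * wt w"]
    by (simp add: case_prod_unfold)
  also have "\<dots> = (\<Sum>y\<in>T. 0)"
  proof (intro sum.cong refl)
    fix y assume "y \<in> T"
    then obtain u v where y: "y = (u, v)" "length u = 1" "length v = k - 1"
      by (auto simp: T_def)
    let ?F = "{(w, I). length w = length u + length v \<and> I \<subseteq> {..<length w} \<and>
                nths w I = u \<and> nths w ({..<length w} - I) = v}"
    \<comment> \<open>The marked set has one element because \<open>u\<close> has length 1, and 1 +
      (k - 1) is k because k is positive.\<close>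
    have "(w, I) \<in> S \<and> \<pi> (w, I) = y \<longleftrightarrow> length w = length u + length v \<and> I \<subseteq> {..<length w}
        \<and> nths w I = u \<and> nths w ({..<length w} - I) = v" for w I
      using y \<open>0 < k\<close> len[of I w] by (auto simp: S_def W_def \<pi>_def)
    then have F: "{(w, I). (w, I) \<in> S \<and> \<pi> (w, I) = y} = ?F"
      by simp
    \<comment> \<open>Scalar weights commute, so the weight of \<open>w\<close> is constant on the
      fibre.\<close>
    have "(\<Sum>(w, I)\<in>?F. \<Phi> w * wt w) = (\<Sum>(w, I)\<in>?F. \<Phi> w * (wt u * wt v))"
      by (intro sum.cong refl) (auto simp: wt_def simp flip: prod_list_nths_complement)
    also have "\<dots> = \<Phi> u * \<Phi> v * (wt u * wt v)"
      using assms(1) by (simp add: group_like_def case_prod_unfold flip: sum_distrib_right)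
    also have "\<dots> = 0"
      using y(2) linear by (auto simp: length_Suc_conv)
    finally show "(\<Sum>(w, I) | (w, I) \<in> S \<and> \<pi> (w, I) = y. \<Phi> w * wt w) = 0"
      unfolding F .
  qed
  finally show ?thesis
    using \<open>0 < k\<close> by (simp add: W_def wt_def)
qed

text \<open>The antisymmetry of an associator says that its inverse is \<open>\<Phi>\<close> with
  the two generators exchanged, so the second case is the first with the two scalars
  exchanged.\<close>

lemma associator_abelianization:
  assumes "drinfeld_associator \<Phi>" "0 < k"
  shows "(\<Sum>w | length w = k. (if \<epsilon> then \<Phi> else nc_inverse \<Phi>) w * (\<Prod>b\<leftarrow>w. g b)) = 0"
proof (cases \<epsilon>)
  case True
  then show ?thesis
    using group_like_abelianization[of \<Phi> k g] drinfeld_associator_linear[OF assms(1)] assms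
    by (simp add: drinfeld_associator_def Let_def)
next
  case False
  have swap: "subst2 \<Phi> {False} {True} = nc_inverse \<Phi>"
    using assms(1) by (simp add: drinfeld_associator_def Let_def)
  then have inverse: "nc_inverse \<Phi> w = \<Phi> (map Not w)" for w
  proof -
    have "set w \<subseteq> {False} \<union> {True}" "map (\<lambda>b. b \<in> {False}) w = map Not w"
      by auto
    then show ?thesis
      using fun_cong[OF swap, of w] unfolding subst2_def by presburger
  qed
  have "(\<Sum>w | length w = k. \<Phi> (map Not w) * (\<Prod>b\<leftarrow>w. g b))
      = (\<Sum>w | length w = k. \<Phi> w * (\<Prod>b\<leftarrow>w. g (\<not> b)))"
    by (rule sum.reindex_bij_witness[where i = "map Not" and j = "map Not"]) (auto simp: comp_def)
  also have "\<dots> = 0"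
    using group_like_abelianization[of \<Phi> k "\<lambda>b. g (\<not> b)"] drinfeld_associator_linear[OF assms(1)] assms
    by (simp add: drinfeld_associator_def Let_def)
  finally show ?thesis
    using False inverse by simp
qed

lemma aug_cabling:
  assumes "drinfeld_associator \<Phi>"
  shows "aug_series (cabling (if \<epsilon> then \<Phi> else nc_inverse \<Phi>) u v w) = 1"
proof (rule fps_ext)
  fix k :: nat
  let ?\<Psi> = "if \<epsilon> then \<Phi> else nc_inverse \<Phi>"
  let ?ss = "u @ v @ w"
  let ?U = "{..<length u}"
  let ?H = "?U \<times> {length u..<length u + length v} \<union> {length u..<length u + length v} \<times> {length u + length v..<length ?ss}"
  have "aug (cabling ?\<Psi> u v w k)
      = (\<Sum>hs | length hs = k \<and> set hs \<subseteq> ?H. ?\<Psi> (map (\<lambda>(i, j). i \<in> ?U) hs) * (\<Prod>(i, j)\<leftarrow>hs. dir (?ss ! i) * dir (?ss ! j)))"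
    unfolding cabling_def Let_def aug_sum by simp
  also have "\<dots> = (\<Sum>w | length w = k. ?\<Psi> w * (\<Prod>b\<leftarrow>w. \<Sum>h | h \<in> ?H \<and> (case h of (i, j) \<Rightarrow> i \<in> ?U) = b.
      case h of (i, j) \<Rightarrow> dir (?ss ! i) * dir (?ss ! j)))"
    by (rule sum_lists_by_type) simp
  also have "\<dots> = (if k = 0 then 1 else 0)"
  proof (cases "k = 0")
    case True
    have "\<Phi> [] = 1"
      using assms by (simp add: drinfeld_associator_def group_like_def Let_def)
    moreover have "nc_inverse \<Phi> [] = \<Phi> []"
      using assms by (auto simp: drinfeld_associator_def Let_def subst2_def dest!: fun_cong[of _ _ "[]"])
    ultimately show ?thesis
      using True by simp
  next
    case False
    then show ?thesis
      using associator_abelianization[OF assms] by simp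
  qed
  finally show "fps_nth (aug_series (cabling ?\<Psi> u v w)) k = fps_nth 1 k"
    by simp
qed

section \<open>Gluing tangle diagrams\<close>

fun erase_arc :: "arc \<Rightarrow> arc" where
  "erase_arc (Arc c p w q) = Arc c p [] q"

text \<open>Gluing looks only at where arcs start and finish, so it commutes with forgetting the
  chords. Boundary conditions thus need to be proved for skeletons only and carry over to every
  diagram with that skeleton.\<close>

definition erase :: "tangle_diagram \<Rightarrow> tangle_diagram" where
  "erase D = (map erase_arc (fst D), map (\<lambda>c. (fst c, [])) (snd D))"

lemma rename_circle_eq: "rename_circle f c = (fst c, map f (snd c))"
  by (cases c) (simp add: rename_circle_def)

lemma erase_arc_sel [simp]:
  "start (erase_arc a) = start a" "finish (erase_arc a) = finish a"
  "colour (erase_arc a) = colour a" "chords (erase_arc a) = []"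
  by (cases a; simp)+

lemma erase_arc_rename [simp]: "erase_arc (rename_arc g f a) = rename_arc g f (erase_arc a)"
  by (cases a) simp

lemma rename_arc_sel [simp]:
  "start (rename_arc g f a) = g (start a)" "finish (rename_arc g f a) = g (finish a)"
  "colour (rename_arc g f a) = colour a" "chords (rename_arc g f a) = map f (chords a)"
  by (cases a; simp)+

lemma find_map: "find P (map f xs) = map_option f (find (P \<circ> f) xs)"
  by (induction xs) auto

lemma erase_join_at: "erase (join_at p D) = join_at p (erase D)"
proof -
  obtain as cs where D: "D = (as, cs)" by (cases D)
  show ?thesis
    by (auto simp: D erase_def find_map comp_def filter_map Let_def split: option.splits)
qed

lemma erase_fold_join_at: "erase (fold join_at ps D) = fold join_at ps (erase D)"
  by (induction ps arbitrary: D) (simp_all add: erase_join_at)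

lemma erase_comp_diagrams: "erase (comp_diagrams n D E) = comp_diagrams n (erase D) (erase E)"
proof -
  obtain as cs as' cs' where DE: "D = (as, cs)" "E = (as', cs')" by (metis surj_pair)
  show ?thesis
    by (simp add: DE erase_fold_join_at) (simp add: erase_def comp_def rename_circle_eq)
qed

lemma erase_juxt_diagrams: "erase (juxt_diagrams b t D E) = juxt_diagrams b t (erase D) (erase E)"
proof -
  obtain as cs as' cs' where DE: "D = (as, cs)" "E = (as', cs')" by (metis surj_pair)
  show ?thesis
    by (simp add: DE erase_def comp_def rename_circle_eq)
qed

lemma erase_arc_between [simp]: "erase_arc (arc_between s p w q) = arc_between s p [] q"
  by (cases s) simp

lemma erase_braid_diagram: "erase (braid_diagram ss \<pi> ws) = braid_diagram ss \<pi> (\<lambda>_. [])"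
  by (simp add: erase_def braid_diagram_def)

lemma erase_cap_diagram: "erase (cap_diagram a w) = cap_diagram a []"
  and erase_cup_diagram: "erase (cup_diagram a w) = cup_diagram a []"
  by (simp_all add: erase_def cap_diagram_def cup_diagram_def)

section \<open>Boundary points and arcs\<close>

lemma strands_juxt [simp]: "strands (juxt u v) = strands u @ strands v"
  by (induction u v rule: juxt.induct) simp_all

text \<open>Points are paired with colours because \<open>join_at\<close> keeps the colour of one of
  the two arcs only; the pairing guarantees that they agree.\<close>

definition ends :: "bool \<Rightarrow> (nat \<Rightarrow> point) \<Rightarrow> strand list \<Rightarrow> (point \<times> nat) set" where
  "ends up P ss = (\<lambda>i. (P i, fst (ss ! i))) ` {i. i < length ss \<and> snd (ss ! i) = up}"

definition arcs_wf :: "(point \<times> nat) set \<Rightarrow> (point \<times> nat) set \<Rightarrow> arc list \<Rightarrow> bool" where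
  "arcs_wf S F as \<longleftrightarrow> distinct (map start as) \<and> distinct (map finish as) \<and>
     (\<lambda>a. (start a, colour a)) ` set as = S \<and> (\<lambda>a. (finish a, colour a)) ` set as = F"

text \<open>Arcs start at the bottom of upward strands and at the top of downward ones.\<close>

definition diagram_wf :: "strand list \<Rightarrow> strand list \<Rightarrow> tangle_diagram \<Rightarrow> bool" where
  "diagram_wf bs ts D \<longleftrightarrow>
     arcs_wf (ends True Bot bs \<union> ends False Top ts) (ends False Bot bs \<union> ends True Top ts) (fst D)"

lemma arcs_wf_erase: "arcs_wf S F (map erase_arc as) = arcs_wf S F as"
  by (simp add: arcs_wf_def comp_def image_image)

lemma diagram_wf_erase: "diagram_wf bs ts (erase D) = diagram_wf bs ts D"
  by (simp add: diagram_wf_def erase_def arcs_wf_erase)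

definition letters :: "tangle_diagram \<Rightarrow> nat multiset" where
  "letters D = (\<Sum>a\<leftarrow>fst D. mset (chords a)) + (\<Sum>c\<leftarrow>snd D. mset (snd c))"

definition colours :: "tangle_diagram \<Rightarrow> nat set" where
  "colours D = colour ` set (fst D) \<union> fst ` set (snd D)"

lemma arcs_wf_rename:
  assumes "arcs_wf S F as" "inj_on g (fst ` S)" "inj_on g (fst ` F)"
  shows "arcs_wf (map_prod g id ` S) (map_prod g id ` F) (map (rename_arc g f) as)"
proof -
  have S: "S = (\<lambda>a. (start a, colour a)) ` set as" and F: "F = (\<lambda>a. (finish a, colour a)) ` set as"
    using assms(1) by (simp_all add: arcs_wf_def)
  have "fst ` S = set (map start as)" "fst ` F = set (map finish as)"
    by (simp_all add: S F image_image)
  then have "inj_on g (set (map start as))" "inj_on g (set (map finish as))"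
    using assms(2,3) by simp_all
  moreover have "distinct (map start as)" "distinct (map finish as)"
    using assms(1) by (simp_all add: arcs_wf_def)
  ultimately have "distinct (map g (map start as))" "distinct (map g (map finish as))"
    by (simp_all only: distinct_map)
  then show ?thesis
    by (simp add: arcs_wf_def S F image_image comp_def)
qed

lemma arcs_wf_append:
  assumes "arcs_wf S F as" "arcs_wf S' F' as'"
    and "fst ` S \<inter> fst ` S' = {}" "fst ` F \<inter> fst ` F' = {}"
  shows "arcs_wf (S \<union> S') (F \<union> F') (as @ as')"
proof -
  have "fst ` S = start ` set as" "fst ` F = finish ` set as"
    "fst ` S' = start ` set as'" "fst ` F' = finish ` set as'"
    using assms(1,2) by (auto simp: arcs_wf_def image_image)
  then show ?thesis
    using assms by (simp add: arcs_wf_def image_Un)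
qed

lemma arcs_wf_Nil: "arcs_wf {} {} as \<longleftrightarrow> as = []"
  by (auto simp: arcs_wf_def)

lemma find_unique:
  assumes "distinct (map f xs)" "x \<in> set xs"
  shows "find (\<lambda>y. f y = f x) xs = Some x"
  using assms by (induction xs) (auto simp: image_iff)

text \<open>Distinct starts and finishes make the arc \<open>a\<close> ending at \<open>p\<close>
  and the arc \<open>b\<close> starting there unique, so the filter removes exactly these two and no
  chord endpoint is lost.\<close>

lemma join_at_wf:
  assumes wf: "arcs_wf S F (fst D)" and p: "(p, c) \<in> S" "(p, c) \<in> F"
  shows "arcs_wf (S - {(p, c)}) (F - {(p, c)}) (fst (join_at p D))"
    and "letters (join_at p D) = letters D"
    and "colours (join_at p D) = colours D"
proof -
  obtain as cs where D: "D = (as, cs)" by (cases D)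
  have dist: "distinct (map start as)" "distinct (map finish as)" "distinct as"
    and S: "S = (\<lambda>a. (start a, colour a)) ` set as" and F: "F = (\<lambda>a. (finish a, colour a)) ` set as"
    using wf by (simp_all add: arcs_wf_def D distinct_map)
  have inj: "inj_on start (set as)" "inj_on finish (set as)"
    using dist by (simp_all add: distinct_map)
  obtain a where a: "a \<in> set as" "finish a = p" "colour a = c"
    using p(2) F by auto
  obtain b where b: "b \<in> set as" "start b = p" "colour b = c"
    using p(1) S by auto
  have uniq: "x = a" if "x \<in> set as" "finish x = p" for x
    using that a inj(2) by (metis inj_onD)
  have uniq': "x = b" if "x \<in> set as" "start x = p" for x
    using that b inj(1) by (metis inj_onD)
  define rest where "rest = filter (\<lambda>x. start x \<noteq> p \<and> finish x \<noteq> p) as"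
  have find: "find (\<lambda>x. finish x = p) as = Some a" "find (\<lambda>x. start x = p) as = Some b"
    using find_unique[OF dist(2) a(1)] find_unique[OF dist(1) b(1)] a b by simp_all
  have rest: "set rest = set as - {a, b}" "distinct rest"
    using a b dist by (auto simp: rest_def dest: uniq uniq')
  have dist_rest: "distinct (map start rest)" "distinct (map finish rest)"
    using dist by (simp_all add: rest_def distinct_map_filter)
  have S': "S - {(p, c)} = (\<lambda>a. (start a, colour a)) ` (set as - {b})"
    using b by (auto simp: S dest: uniq')
  have F': "F - {(p, c)} = (\<lambda>a. (finish a, colour a)) ` (set as - {a})"
    using a by (auto simp: F dest: uniq)
  have "arcs_wf (S - {(p, c)}) (F - {(p, c)}) (fst (join_at p D))
    \<and> letters (join_at p D) = letters D \<and> colours (join_at p D) = colours D"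
  \<comment> \<open>An arc that starts where it ends is both \<open>a\<close> and \<open>b\<close>,
    and closes up to a circle.\<close>
  proof (cases "start a = p")
    case True
    then have "b = a"
      using a b inj by (metis inj_onD)
    have join: "join_at p D = (rest, (c, chords a) # cs)"
      using find True a by (simp add: D rest_def)
    have "mset as = mset (a # rest)"
      using rest a \<open>b = a\<close> dist by (subst set_eq_iff_mset_eq_distinct[symmetric]) auto
    then have "letters D = letters (join_at p D)"
      unfolding join by (simp add: D letters_def flip: sum_mset_sum_list)
    moreover have "set as = insert a (set rest)"
      using rest a \<open>b = a\<close> by auto
    then have "colours D = colours (join_at p D)"
      unfolding join using a by (simp add: D colours_def)
    ultimately show ?thesis
      using rest dist_rest S' F' \<open>b = a\<close> by (simp add: join arcs_wf_def)
  next
    case False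
    then have "b \<noteq> a"
      using b by auto
    let ?n = "Arc c (start a) (chords a @ chords b) (finish b)"
    have join: "join_at p D = (?n # rest, cs)"
      using find False a by (simp add: D rest_def)
    have "mset as = mset (a # b # rest)"
      using rest a b \<open>b \<noteq> a\<close> dist by (subst set_eq_iff_mset_eq_distinct[symmetric]) auto
    then have "letters D = letters (join_at p D)"
      unfolding join by (simp add: D letters_def flip: sum_mset_sum_list)
    moreover have "set as = insert a (insert b (set rest))"
      using rest a b by auto
    then have "colours D = colours (join_at p D)"
      unfolding join using a b by (simp add: D colours_def)
    moreover have "start a \<notin> start ` set rest" "finish b \<notin> finish ` set rest"
      using rest a b inj by (auto dest: inj_onD)
    moreover have "set as - {b} = insert a (set rest)" "set as - {a} = insert b (set rest)"
      using rest a b \<open>b \<noteq> a\<close> by auto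
    ultimately show ?thesis
      using dist_rest S' F' a b by (simp add: join arcs_wf_def)
  qed
  then show "arcs_wf (S - {(p, c)}) (F - {(p, c)}) (fst (join_at p D))"
    "letters (join_at p D) = letters D" "colours (join_at p D) = colours D"
    by auto
qed

lemma fold_join_at_wf:
  assumes "arcs_wf S F (fst D)" "set qs \<subseteq> S" "set qs \<subseteq> F" "distinct qs"
  shows "arcs_wf (S - set qs) (F - set qs) (fst (fold join_at (map fst qs) D))
    \<and> letters (fold join_at (map fst qs) D) = letters D
    \<and> colours (fold join_at (map fst qs) D) = colours D"
  using assms
proof (induction qs arbitrary: S F D)
  case (Cons q qs)
  obtain p c where q: "q = (p, c)" by (cases q)
  have pc: "(p, c) \<in> S" "(p, c) \<in> F"
    using Cons.prems q by auto
  note join = join_at_wf[OF Cons.prems(1) pc]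
  have "set qs \<subseteq> S - {(p, c)}" "set qs \<subseteq> F - {(p, c)}"
    using Cons.prems q by auto
  note IH = Cons.IH[OF join(1) this]
  have "X - {(p, c)} - set qs = X - set (q # qs)" for X
    using q by auto
  then show ?case
    using IH Cons.prems(4) q join(2,3) by simp
qed simp

lemma map_prod_ends: "map_prod g id ` ends up P ss = ends up (\<lambda>i. g (P i)) ss"
  by (simp add: ends_def image_image)

lemma ends_append: "ends up P (ss @ ss') = ends up P ss \<union> ends up (\<lambda>i. P (length ss + i)) ss'"
proof -
  let ?I = "{i. i < length ss \<and> snd (ss ! i) = up}" and ?I' = "{i. i < length ss' \<and> snd (ss' ! i) = up}"
  have "{i. i < length (ss @ ss') \<and> snd ((ss @ ss') ! i) = up} = ?I \<union> (+) (length ss) ` ?I'"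
  proof (intro subset_antisym subsetI)
    fix i assume i: "i \<in> {i. i < length (ss @ ss') \<and> snd ((ss @ ss') ! i) = up}"
    show "i \<in> ?I \<union> (+) (length ss) ` ?I'"
    proof (cases "i < length ss")
      case False
      then have "i - length ss \<in> ?I'" "i = length ss + (i - length ss)"
        using i by (auto simp: nth_append)
      then show ?thesis
        by blast
    qed (use i in \<open>simp add: nth_append\<close>)
  qed (auto simp: nth_append)
  then show ?thesis
    by (simp add: ends_def image_Un image_image nth_append)
qed

lemma ends_Nil [simp]: "ends up P [] = {}"
  by (simp add: ends_def)

lemma ends_singleton: "ends up P [s] = (if snd s = up then {(P 0, fst s)} else {})"
  by (auto simp: ends_def)

lemma ends_pair: "ends up P [s, s'] = ends up P [s] \<union> ends up (\<lambda>i. P (Suc i)) [s']"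
  using ends_append[of up P "[s]" "[s']"] by simp

lemma letters_rename:
  "letters (map (rename_arc g f) as, map (rename_circle f) cs) = image_mset f (letters (as, cs))"
  by (induction as; induction cs) (simp_all add: letters_def rename_circle_def)

lemma letters_append: "letters (as @ as', cs @ cs') = letters (as, cs) + letters (as', cs')"
  by (simp add: letters_def)

lemma colours_rename:
  "colours (map (rename_arc g f) as @ map (rename_arc g' f') as', map (rename_circle f) cs @ map (rename_circle f') cs')
    = colours (as, cs) \<union> colours (as', cs')"
  by (auto simp: colours_def image_image image_Un rename_circle_def)

text \<open>At a gluing point of an upward strand the lower arc finishes and the upper one starts;
  for a downward strand it is the reverse. So each \<open>Mid\<close> point occurs exactly once
  among the starts and once among the finishes, with the same colour.\<close>

lemma comp_diagrams_wf:
  assumes D: "diagram_wf bs ms D" and E: "diagram_wf ms ts E"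
  shows "diagram_wf bs ts (comp_diagrams (length ms) D E)"
    and "letters (comp_diagrams (length ms) D E) = image_mset even_name (letters D) + image_mset odd_name (letters E)"
    and "colours (comp_diagrams (length ms) D E) = colours D \<union> colours E"
proof -
  obtain as cs where Deq: "D = (as, cs)" by (cases D)
  obtain as' cs' where Eeq: "E = (as', cs')" by (cases E)
  define G where "G = (map (rename_arc top_to_mid even_name) as @ map (rename_arc bot_to_mid odd_name) as',
      map (rename_circle even_name) cs @ map (rename_circle odd_name) cs')"
  define qs where "qs = map (\<lambda>i. (Mid i, fst (ms ! i))) [0..<length ms]"
  have comp: "comp_diagrams (length ms) D E = fold join_at (map fst qs) G"
    by (simp add: Deq Eeq G_def qs_def comp_def)
  let ?S = "(ends True Bot bs \<union> ends False Mid ms) \<union> (ends True Mid ms \<union> ends False Top ts)"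
  let ?F = "(ends False Bot bs \<union> ends True Mid ms) \<union> (ends False Mid ms \<union> ends True Top ts)"
  have inj: "inj_on top_to_mid (fst ` (ends up Bot bs \<union> ends up' Top ms))"
    "inj_on bot_to_mid (fst ` (ends up Bot ms \<union> ends up' Top ts))" for up up'
    by (auto simp: inj_on_def ends_def)
  have "arcs_wf (ends True Bot bs \<union> ends False Mid ms) (ends False Bot bs \<union> ends True Mid ms)
      (map (rename_arc top_to_mid even_name) as)"
    using arcs_wf_rename[OF D[unfolded diagram_wf_def] inj(1) inj(1), of even_name]
    by (simp add: Deq image_Un map_prod_ends)
  moreover have "arcs_wf (ends True Mid ms \<union> ends False Top ts) (ends False Mid ms \<union> ends True Top ts)
      (map (rename_arc bot_to_mid odd_name) as')"
    using arcs_wf_rename[OF E[unfolded diagram_wf_def] inj(2) inj(2), of odd_name]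
    by (simp add: Eeq image_Un map_prod_ends)
  ultimately have wf: "arcs_wf ?S ?F (fst G)"
    unfolding G_def fst_conv by (rule arcs_wf_append) (auto simp: ends_def)
  have set_qs: "set qs = ends True Mid ms \<union> ends False Mid ms"
    by (auto simp: qs_def ends_def)
  have "distinct qs"
    by (auto simp: qs_def distinct_map inj_on_def)
  have fold: "arcs_wf (?S - set qs) (?F - set qs) (fst (fold join_at (map fst qs) G))
    \<and> letters (fold join_at (map fst qs) G) = letters G
    \<and> colours (fold join_at (map fst qs) G) = colours G"
    by (rule fold_join_at_wf[OF wf _ _ \<open>distinct qs\<close>]) (auto simp: set_qs)
  have letters: "letters G = image_mset even_name (letters D) + image_mset odd_name (letters E)"
    and colours: "colours G = colours D \<union> colours E"
    by (simp_all add: Deq Eeq G_def letters_append letters_rename colours_rename)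
  have "ends up Bot bs \<inter> set qs = {}" "ends up Top ts \<inter> set qs = {}" for up
    by (auto simp: set_qs ends_def)
  then have "?S - set qs = ends True Bot bs \<union> ends False Top ts" "?F - set qs = ends False Bot bs \<union> ends True Top ts"
    using set_qs by blast+
  then show "diagram_wf bs ts (comp_diagrams (length ms) D E)"
    using fold by (simp add: diagram_wf_def comp)
  show "letters (comp_diagrams (length ms) D E) = image_mset even_name (letters D) + image_mset odd_name (letters E)"
    using fold letters by (simp add: comp)
  show "colours (comp_diagrams (length ms) D E) = colours D \<union> colours E"
    using fold colours by (simp add: comp)
qed

lemma juxt_diagrams_wf:
  assumes D: "diagram_wf bs ts D" and E: "diagram_wf bs' ts' E"
  shows "diagram_wf (bs @ bs') (ts @ ts') (juxt_diagrams (length bs) (length ts) D E)"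
    and "letters (juxt_diagrams (length bs) (length ts) D E) = image_mset even_name (letters D) + image_mset odd_name (letters E)"
    and "colours (juxt_diagrams (length bs) (length ts) D E) = colours D \<union> colours E"
proof -
  obtain as cs where Deq: "D = (as, cs)" by (cases D)
  obtain as' cs' where Eeq: "E = (as', cs')" by (cases E)
  let ?g = "shift_point (length bs) (length ts)"
  let ?B = "\<lambda>i. Bot (length bs + i)" and ?T = "\<lambda>i. Top (length ts + i)"
  have inj: "inj_on ?g (fst ` (ends up Bot bs' \<union> ends up' Top ts'))" for up up'
    by (auto simp: inj_on_def ends_def)
  have "arcs_wf (ends True Bot bs \<union> ends False Top ts) (ends False Bot bs \<union> ends True Top ts)
      (map (rename_arc id even_name) as)"
    using arcs_wf_rename[OF D[unfolded diagram_wf_def], of id even_name]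
    by (simp add: Deq image_Un map_prod_ends)
  moreover have "arcs_wf (ends True ?B bs' \<union> ends False ?T ts') (ends False ?B bs' \<union> ends True ?T ts')
      (map (rename_arc ?g odd_name) as')"
    using arcs_wf_rename[OF E[unfolded diagram_wf_def] inj inj, of odd_name]
    by (simp add: Eeq image_Un map_prod_ends)
  ultimately have "arcs_wf ((ends True Bot bs \<union> ends False Top ts) \<union> (ends True ?B bs' \<union> ends False ?T ts'))
      ((ends False Bot bs \<union> ends True Top ts) \<union> (ends False ?B bs' \<union> ends True ?T ts'))
      (map (rename_arc id even_name) as @ map (rename_arc ?g odd_name) as')"
    by (rule arcs_wf_append) (auto simp: ends_def)
  then show "diagram_wf (bs @ bs') (ts @ ts') (juxt_diagrams (length bs) (length ts) D E)"
    by (simp add: diagram_wf_def Deq Eeq ends_append ac_simps)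
  show "letters (juxt_diagrams (length bs) (length ts) D E) = image_mset even_name (letters D) + image_mset odd_name (letters E)"
    by (simp add: Deq Eeq letters_append letters_rename)
  show "colours (juxt_diagrams (length bs) (length ts) D E) = colours D \<union> colours E"
    by (simp add: Deq Eeq colours_rename)
qed

section \<open>Diagrams occurring in the Kontsevich integral\<close>

lemma arc_between_sel [simp]:
  "start (arc_between s p w q) = (if snd s then p else q)"
  "finish (arc_between s p w q) = (if snd s then q else p)"
  "colour (arc_between s p w q) = fst s"
  "mset (chords (arc_between s p w q)) = mset w"
  by (cases s; simp)+

lemma image_strand_ends:
  "(\<lambda>i. (if snd (ss ! i) then P i else Q i, fst (ss ! i))) ` {0..<length ss} = ends True P ss \<union> ends False Q ss"
  (is "?f ` _ = _")
proof -
  let ?I = "\<lambda>up. {i. i < length ss \<and> snd (ss ! i) = up}"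
  have "{0..<length ss} = ?I True \<union> ?I False"
    by auto
  then have "?f ` {0..<length ss} = ?f ` ?I True \<union> ?f ` ?I False"
    by (simp only: image_Un)
  moreover have "?f ` ?I True = ends True P ss" "?f ` ?I False = ends False Q ss"
    unfolding ends_def by (intro image_cong refl; simp)+
  ultimately show ?thesis
    by simp
qed

lemma braid_diagram_wf: "diagram_wf ss ss (braid_diagram ss id ws)"
proof -
  have "inj_on (\<lambda>i. if snd (ss ! i) then P i else Q i) A"
    if "\<And>i j. P i = P j \<Longrightarrow> i = j" "\<And>i j. Q i = Q j \<Longrightarrow> i = j" "\<And>i j. P i \<noteq> Q j"
    for P Q :: "nat \<Rightarrow> point" and A
    using that unfolding inj_on_def by (metis (full_types))
  from this[of Bot Top] this[of Top Bot] show ?thesis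
    using image_strand_ends[of ss Bot Top] image_strand_ends[of ss Top Bot]
    by (simp add: diagram_wf_def braid_diagram_def arcs_wf_def comp_def distinct_map image_image Un_commute)
qed

lemma crossing_diagram_wf: "diagram_wf [a, b] [b, a] (crossing_diagram a b w)"
  by (auto simp: diagram_wf_def crossing_diagram_def braid_diagram_def arcs_wf_def ends_pair
      ends_singleton upt_rec)

lemma cap_diagram_wf: "diagram_wf [a, opp a] [] (cap_diagram a w)"
  and cup_diagram_wf: "diagram_wf [] [a, opp a] (cup_diagram a w)"
  by (auto simp: diagram_wf_def cap_diagram_def cup_diagram_def arcs_wf_def ends_pair ends_singleton)

lemma skeleton_wf:
  assumes "is_qtangle L"
  shows "diagram_wf (strands (bottom L)) (strands (top_word L)) (skeleton L)"
  using assms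
proof (induction L)
  case (Comp S T)
  then show ?case by (simp add: comp_diagrams_wf(1))
next
  case (Juxt S T)
  then show ?case by (simp add: juxt_diagrams_wf(1))
qed (simp_all add: braid_diagram_wf crossing_diagram_wf cap_diagram_wf cup_diagram_wf horizontal_diagram_def)

text \<open>For a link the colours are the numbers below m, so this places every crossing at an
  entry of the m by m matrix.\<close>

lemma crossings_colours:
  assumes "is_qtangle L" "(s, a, b) \<in> set (crossings L)"
  shows "a \<in> colours (skeleton L) \<and> b \<in> colours (skeleton L)"
  using assms
proof (induction L)
  case (Crossing \<epsilon> x y)
  then show ?case
    by (simp add: crossing_diagram_def braid_diagram_def colours_def upt_rec)
next
  case (Comp S T)
  then have "colours (skeleton (Comp S T)) = colours (skeleton S) \<union> colours (skeleton T)"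
    using skeleton_wf[of S] skeleton_wf[of T] by (simp add: comp_diagrams_wf(3))
  then show ?case
    using Comp by auto
next
  case (Juxt S T)
  then have "colours (skeleton (Juxt S T)) = colours (skeleton S) \<union> colours (skeleton T)"
    using skeleton_wf[of S] skeleton_wf[of T] by (simp add: juxt_diagrams_wf(3))
  then show ?case
    using Juxt by auto
qed auto

lemma pairedI:
  assumes "\<And>x. count M x = (if x < k then 2 else 0)"
  shows "paired k M"
proof -
  have "M = mset [0..<k] + mset [0..<k]"
    by (rule multiset_eqI) (simp add: assms count_mset_distinct del: mset_upt)
  then show ?thesis
    by (simp add: paired_def count_mset_distinct del: mset_upt)
qed

lemma letters_braid_diagram: "letters (braid_diagram ss \<pi> ws) = (\<Sum>i<length ss. mset (ws i))"
  by (simp add: letters_def braid_diagram_def comp_def interv_sum_list_conv_sum_set_nat atLeast0LessThan)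

text \<open>The name of the x-th chord appears once on each of the two strands in
  \<open>hs ! x\<close>, and these are different since i < j.\<close>

lemma paired_horizontal_diagram:
  assumes "\<And>i j. (i, j) \<in> set hs \<Longrightarrow> i < j \<and> j < length ss"
  shows "paired (length hs) (letters (horizontal_diagram ss hs))"
proof (rule pairedI)
  fix x
  have "count (letters (horizontal_diagram ss hs)) x
      = (\<Sum>i<length ss. if x < length hs \<and> (fst (hs ! x) = i \<or> snd (hs ! x) = i) then 1 else 0)"
    unfolding horizontal_diagram_def letters_braid_diagram count_sum
    by (intro sum.cong refl) (simp add: count_mset_distinct del: mset_filter)
  also have "\<dots> = (if x < length hs then 2 else 0)"
  proof (cases "x < length hs")
    case True
    then obtain i j where ij: "hs ! x = (i, j)" "i < j" "j < length ss"
      using assms nth_mem by (metis surj_pair)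
    then have "{l \<in> {..<length ss}. i = l \<or> j = l} = {i, j}"
      by auto
    then show ?thesis
      using True ij by (simp flip: sum.inter_filter)
  qed simp
  finally show "count (letters (horizontal_diagram ss hs)) x = (if x < length hs then 2 else 0)" .
qed

lemma paired_cap_cup:
  assumes "w \<in> Poly_Mapping.keys (sqrt_nu k)"
  shows "paired k (letters (cap_diagram a w))" "paired k (letters (cup_diagram a w))"
  using keys_sqrt_nu[OF assms] by (simp_all add: cap_diagram_def cup_diagram_def letters_def)

text \<open>The skeleton is carried along because the boundary conditions it implies are what makes
  \<open>letters\<close> additive under gluing.\<close>

lemma keys_Z_tangle:
  assumes "is_qtangle L" "D \<in> Poly_Mapping.keys (Z_tangle \<Phi> L k)"
  shows "erase D = skeleton L \<and> paired k (letters D)"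
  using assms
proof (induction L arbitrary: D k)
  case (Strand a)
  then show ?case
    by (simp add: keys_in_degree_0 erase_braid_diagram letters_braid_diagram paired_def)
next
  case (Crossing \<epsilon> a b)
  then have "D = crossing_diagram a b [0..<k]"
    by (auto simp: Z_crossing_def dest!: subsetD[OF keys_smul])
  moreover have "paired k (letters (crossing_diagram a b [0..<k]))"
    by (rule pairedI)
      (simp add: crossing_diagram_def letters_braid_diagram numeral_2_eq_2 count_mset_distinct del: mset_upt)
  ultimately show ?case
    by (simp add: crossing_diagram_def erase_braid_diagram)
next
  case (Cap a)
  then show ?case
    by (auto elim!: keys_lin_ext_elim simp: erase_cap_diagram paired_cap_cup)
next
  case (Cup a)
  then show ?case
    by (auto elim!: keys_lin_ext_elim simp: erase_cup_diagram paired_cap_cup)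
next
  case (Assoc \<epsilon> u v w)
  let ?ss = "strands u @ strands v @ strands w"
  obtain hs where hs: "length hs = k" "D = horizontal_diagram ?ss hs"
    "set hs \<subseteq> {..<length (strands u)} \<times> {length (strands u)..<length (strands u) + length (strands v)}
      \<union> {length (strands u)..<length (strands u) + length (strands v)} \<times> {length (strands u) + length (strands v)..<length ?ss}"
    using Assoc.prems(2) unfolding Z_tangle.simps cabling_def Let_def
    by (elim keys_sum_elim) (auto dest!: subsetD[OF keys_smul])
  have "paired (length hs) (letters (horizontal_diagram ?ss hs))"
    by (rule paired_horizontal_diagram) (use hs(3) in auto)
  then show ?case
    using hs by (simp add: horizontal_diagram_def erase_braid_diagram)
next
  case (Comp S T)
  obtain i D1 D2 where i: "i \<le> k" "D1 \<in> Poly_Mapping.keys (Z_tangle \<Phi> S i)"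
    "D2 \<in> Poly_Mapping.keys (Z_tangle \<Phi> T (k - i))"
    and D: "D = comp_diagrams (length (strands (top_word S))) D1 D2"
    using Comp.prems(2) unfolding Z_tangle.simps by (elim keys_graded_ext_elim)
  have D1: "erase D1 = skeleton S" "paired i (letters D1)"
    and D2: "erase D2 = skeleton T" "paired (k - i) (letters D2)"
    using Comp i by auto
  \<comment> \<open>\<open>diagram_wf\<close> ignores chords, so it passes from the skeletons to
    \<open>D1\<close> and \<open>D2\<close>.\<close>
  have "diagram_wf (strands (bottom S)) (strands (top_word S)) D1"
    "diagram_wf (strands (top_word S)) (strands (top_word T)) D2"
    using skeleton_wf[of S] skeleton_wf[of T] Comp.prems(1) D1(1) D2(1)
    by (metis diagram_wf_erase is_qtangle.simps(1))+
  note wf = comp_diagrams_wf[OF this]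
  show ?case
    using wf(2) paired_rename[OF D1(2) D2(2)] i(1) D1(1) D2(1)
    by (simp add: D erase_comp_diagrams)
next
  case (Juxt S T)
  obtain i D1 D2 where i: "i \<le> k" "D1 \<in> Poly_Mapping.keys (Z_tangle \<Phi> S i)"
    "D2 \<in> Poly_Mapping.keys (Z_tangle \<Phi> T (k - i))"
    and D: "D = juxt_diagrams (length (strands (bottom S))) (length (strands (top_word S))) D1 D2"
    using Juxt.prems(2) unfolding Z_tangle.simps by (elim keys_graded_ext_elim)
  have D1: "erase D1 = skeleton S" "paired i (letters D1)"
    and D2: "erase D2 = skeleton T" "paired (k - i) (letters D2)"
    using Juxt i by auto
  have "diagram_wf (strands (bottom S)) (strands (top_word S)) D1"
    "diagram_wf (strands (bottom T)) (strands (top_word T)) D2"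
    using skeleton_wf[of S] skeleton_wf[of T] Juxt.prems(1) D1(1) D2(1)
    by (metis diagram_wf_erase is_qtangle.simps(2))+
  note wf = juxt_diagrams_wf[OF this]
  show ?case
    using wf(2) paired_rename[OF D1(2) D2(2)] i(1) D1(1) D2(1)
    by (simp add: D erase_juxt_diagrams)
qed

section \<open>Linking numbers and the main theorem\<close>

lemma aug_series_lin_ext: "aug_series (\<lambda>k. lin_ext f (x k)) = aug_series x"
  by (rule fps_ext) simp

text \<open>The signs for reversing strands turn the sign of the upward crossing into that of the
  oriented crossing, as recorded by \<open>crossings\<close>.\<close>

lemma aug_Z_crossing:
  "aug_series (Z_crossing \<epsilon> a b) = fps_exp ((if \<epsilon> then 1 else -1) * dir a * dir b / 2)"
  by (rule fps_ext) (simp add: Z_crossing_def power_mult_distrib power_divide)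

lemma aug_Z_tangle:
  assumes "drinfeld_associator \<Phi>"
  shows "aug_series (Z_tangle \<Phi> L) = fps_exp (\<Sum>(s, a, b)\<leftarrow>crossings L. s / 2)"
  by (induction L)
    (simp_all add: aug_Z_crossing aug_series_lin_ext aug_sqrt_nu aug_cabling[OF assms] fps_exp_add_mult)

lemma finite_upper_pairs: "finite {(i :: nat, j). i \<le> j \<and> j < m}"
  by (rule finite_subset[of _ "{..<m} \<times> {..<m}"]) auto

text \<open>Each crossing involves one unordered pair of components, hence one entry on or above the
  diagonal, and it contributes s/2 there in either case.\<close>

lemma sum_ell:
  assumes "\<And>s a b. (s, a, b) \<in> set (crossings L) \<Longrightarrow> a < m \<and> b < m"
  shows "(\<Sum>(i, j) | i \<le> j \<and> j < m. ell L i j) = (\<Sum>(s, a, b)\<leftarrow>crossings L. s / 2)"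
proof -
  let ?P = "{(i, j). i \<le> j \<and> j < m}"
  define e where "e i j x = (case x of (s, a, b) \<Rightarrow> if {a, b} = {i, j} then s / 2 else (0 :: rat))"
    for i j :: nat and x
  have ell: "ell L i j = (\<Sum>x\<leftarrow>crossings L. e i j x)" for i j
  proof -
    have e: "(\<Sum>x\<leftarrow>xs. e i j x) = (\<Sum>(s, a, b)\<leftarrow>xs. if {a, b} = {i, j} then s else 0) / 2" for xs
      by (induction xs) (auto simp: e_def add_divide_distrib)
    show ?thesis
    proof (cases "i = j")
      case True
      have "framing L j = (\<Sum>(s, a, b)\<leftarrow>crossings L. if {a, b} = {j, j} then s else 0)"
        unfolding framing_def by (intro arg_cong[where f = sum_list] map_cong refl) auto
      then show ?thesis
        unfolding e unfolding ell_def True by (simp only: refl if_True)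
    qed (simp only: e ell_def linking_number_def if_False)
  qed
  have "(\<Sum>(i, j)\<in>?P. e i j x) = (case x of (s, a, b) \<Rightarrow> s / 2)" if "x \<in> set (crossings L)" for x
  proof -
    obtain s a b where x: "x = (s, a, b)" by (cases x)
    then have m: "a < m" "b < m"
      using assms that by auto
    have "{a, b} = {i, j} \<longleftrightarrow> (i, j) = (min a b, max a b)" if "i \<le> j" for i j
      using that by (auto simp: doubleton_eq_iff min_def max_def)
    then have "(\<Sum>(i, j)\<in>?P. e i j x) = (\<Sum>p\<in>?P. if p = (min a b, max a b) then s / 2 else 0)"
      by (intro sum.cong refl) (simp add: e_def x split: prod.splits)
    also have "\<dots> = s / 2"
      using m by (simp add: sum.delta[OF finite_upper_pairs])
    finally show ?thesis
      by (simp add: x)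
  qed
  then have "(\<Sum>x\<leftarrow>crossings L. \<Sum>(i, j)\<in>?P. e i j x) = (\<Sum>(s, a, b)\<leftarrow>crossings L. s / 2)"
    by (intro arg_cong[where f = sum_list] map_cong refl) auto
  moreover have "(\<Sum>(i, j)\<in>?P. \<Sum>x\<leftarrow>xs. e i j x) = (\<Sum>x\<leftarrow>xs. \<Sum>(i, j)\<in>?P. e i j x)" for xs
    by (induction xs) (simp_all add: case_prod_unfold sum.distrib)
  ultimately show ?thesis
    by (simp add: ell)
qed

text \<open>The multinomial theorem, obtained by comparing coefficients of degree k in the
  exponential of a sum and the product of exponentials.\<close>

lemma sum_multisets_exp:
  fixes x :: "'a \<Rightarrow> rat"
  assumes "finite A"
  shows "(\<Sum>X\<in>multisets_of_size A k. \<Prod>a\<in>A. x a ^ count X a / fact (count X a))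
       = (\<Sum>a\<in>A. x a) ^ k / fact k"
proof -
  have "fps_exp (\<Sum>a\<in>A. x a) = (\<Prod>a\<in>A. fps_exp (x a))"
    using assms by (induction A) (simp_all add: fps_exp_add_mult)
  then have "fps_nth (fps_exp (\<Sum>a\<in>A. x a)) k = fps_nth (\<Prod>a\<in>A. fps_exp (x a)) k"
    by simp
  then show ?thesis
    by (simp add: fps_prod_nth'[OF assms])
qed

text \<open>A symmetric matrix is determined by its entries on and above the diagonal, read as
  multiplicities in a multiset of index pairs.\<close>

lemma sum_sym_mats:
  "(\<Sum>S | S \<in> sym_mats m \<and> mat_size m S = k. ell_mat m L S)
    = (\<Sum>(i, j) | i \<le> j \<and> j < m. ell L i j) ^ k / fact k"
proof -
  let ?P = "{(i, j). i \<le> j \<and> j < m}"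
  \<comment> \<open>The cutoff outside \<open>?P\<close> provides the finite support required by
    \<open>Abs_multiset\<close>; in \<open>N\<close>, \<open>min\<close> and \<open>max\<close>
    reflect the lower triangle to the upper one.\<close>
  define M where "M S = Abs_multiset (\<lambda>p. if p \<in> ?P then S $$ p else 0)" for S :: "nat mat"
  define N where "N X = mat m m (\<lambda>(i, j). count X (min i j, max i j))" for X :: "(nat \<times> nat) multiset"
  have "finite {p. 0 < (if p \<in> ?P then S $$ p else 0)}" for S :: "nat mat"
    by (rule finite_subset[OF _ finite_upper_pairs[of m]]) (auto split: if_splits)
  then have count_M: "count (M S) p = (if p \<in> ?P then S $$ p else 0)" for S p
    by (simp add: M_def)
  have size: "size X = (\<Sum>p\<in>?P. count X p)" if "set_mset X \<subseteq> ?P" for X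
    unfolding size_multiset_overloaded_eq
    using that finite_upper_pairs[of m] by (intro sum.mono_neutral_left) (auto simp: not_in_iff)
  have N_sym: "N X \<in> sym_mats m" for X
    by (auto simp: N_def sym_mats_def min.commute max.commute intro!: eq_matI)
  have N_entry: "N X $$ p = count X p" if "p \<in> ?P" for X p
    using that by (auto simp: N_def min_def max_def)
  have MN: "M (N X) = X" if "set_mset X \<subseteq> ?P" for X
    using that by (intro multiset_eqI) (auto simp: count_M N_entry not_in_iff subset_iff)
  have NM: "N (M S) = S" if "S \<in> sym_mats m" for S
  proof (rule eq_matI)
    have S: "S \<in> carrier_mat m m" "transpose_mat S = S"
      using that by (auto simp: sym_mats_def)
    then show "dim_row (N (M S)) = dim_row S" "dim_col (N (M S)) = dim_col S"
      by (auto simp: N_def)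
    fix i j assume "i < dim_row S" "j < dim_col S"
    then have ij: "i < m" "j < m"
      using S by auto
    then have "S $$ (j, i) = S $$ (i, j)"
      using S by (metis carrier_matD index_transpose_mat(1))
    then show "N (M S) $$ (i, j) = S $$ (i, j)"
      using ij by (auto simp: N_def count_M min_def max_def)
  qed
  have set_M: "set_mset (M S) \<subseteq> ?P" for S
    by (rule subsetI) (metis count_M not_in_iff)
  have size_M: "size (M S) = mat_size m S" for S
    unfolding size[OF set_M] mat_size_def by (intro sum.cong refl) (auto simp: count_M)
  have "(\<Sum>S | S \<in> sym_mats m \<and> mat_size m S = k. ell_mat m L S)
      = (\<Sum>X\<in>multisets_of_size ?P k. \<Prod>p\<in>?P. (case p of (i, j) \<Rightarrow> ell L i j) ^ count X p / fact (count X p))"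
  proof (rule sum.reindex_bij_witness[where i = N and j = M])
    fix S assume S: "S \<in> {S. S \<in> sym_mats m \<and> mat_size m S = k}"
    then show "N (M S) = S" "M S \<in> multisets_of_size ?P k"
      using NM set_M size_M by (auto simp: multisets_of_size_def)
    show "(\<Prod>p\<in>?P. (case p of (i, j) \<Rightarrow> ell L i j) ^ count (M S) p / fact (count (M S) p)) = ell_mat m L S"
      unfolding ell_mat_def by (intro prod.cong refl) (auto simp: count_M)
  next
    fix X assume "X \<in> multisets_of_size ?P k"
    then have X: "set_mset X \<subseteq> ?P" "size X = k"
      by (auto simp: multisets_of_size_def)
    then show "M (N X) = X" "N X \<in> {S. S \<in> sym_mats m \<and> mat_size m S = k}"
      using MN N_sym size_M[of "N X"] by auto
  qed
  then show ?thesis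
    by (simp only: sum_multisets_exp[OF finite_upper_pairs])
qed

text \<open>Without boundary points there are no arcs, so all chord endpoints lie on circles. These
  are labelled bijectively by the numbers below m, so listing them by label reads each endpoint
  exactly once.\<close>

lemma closed_diagram_in_chord_diagrams:
  assumes "is_framed_link m L" "erase D = skeleton L" "paired k (letters D)"
  shows "closed_diagram m D \<in> chord_diagrams m k"
proof -
  obtain as cs where D: "D = (as, cs)" by (cases D)
  have "diagram_wf [] [] (skeleton L)"
    using skeleton_wf[of L] assms(1) by (simp add: is_framed_link_def)
  then have "as = []"
    using assms(2) diagram_wf_erase[of "[]" "[]" D] by (simp add: diagram_wf_def arcs_wf_Nil D)
  have "map fst cs = map fst (snd (skeleton L))"
    unfolding assms(2)[symmetric] by (simp add: erase_def D comp_def)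
  then have cs: "distinct (map fst cs)" "set (map fst cs) = {..<m}"
    using assms(1) by (simp_all add: is_framed_link_def)
  let ?w = "\<lambda>i. the (map_of cs i)"
  have "mset (concat (map ?w [0..<m])) = (\<Sum>i<m. mset (?w i))"
    by (simp add: mset_concat comp_def interv_sum_list_conv_sum_set_nat atLeast0LessThan)
  also have "\<dots> = (\<Sum>i\<in>set (map fst cs). mset (?w i))"
    by (simp only: cs(2))
  also have "\<dots> = (\<Sum>i\<leftarrow>map fst cs. mset (?w i))"
    using cs(1) by (simp only: sum_list_distinct_conv_sum_set)
  also have "\<dots> = (\<Sum>c\<leftarrow>cs. mset (snd c))"
    using cs(1) by (auto intro!: arg_cong[where f = sum_list])
  also have "\<dots> = letters D"
    by (simp add: letters_def D \<open>as = []\<close>)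
  finally have letters: "mset (concat (map ?w [0..<m])) = letters D" .
  have "count_list (concat (map ?w [0..<m])) x = count (letters D) x" for x
    unfolding letters[symmetric] by (rule count_mset[symmetric])
  moreover have "set (concat (map ?w [0..<m])) = set_mset (letters D)"
    unfolding letters[symmetric] by simp
  moreover have "length (concat (map ?w [0..<m])) = size (letters D)"
    unfolding letters[symmetric] by simp
  ultimately have "map ?w [0..<m] \<in> degree_codes m k"
    using assms(3) by (simp add: degree_codes_def is_code_def paired_def del: set_concat)
  then show ?thesis
    by (simp add: closed_diagram_def diagram_of_code_in_chord_diagrams_iff D)
qed

lemma crossing_colours_less:
  assumes "is_framed_link m L" "(s, a, b) \<in> set (crossings L)"
  shows "a < m \<and> b < m"
proof -
  have "diagram_wf [] [] (skeleton L)"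
    using skeleton_wf[of L] assms(1) by (simp add: is_framed_link_def)
  then have "colours (skeleton L) = {..<m}"
    using assms(1) by (simp add: diagram_wf_def arcs_wf_Nil colours_def is_framed_link_def)
  then show ?thesis
    using crossings_colours[of L s a b] assms by (simp add: is_framed_link_def)
qed

theorem mainTheorem4:
  fixes m k :: nat
    and \<Phi> :: "bool ncseries"
    and L :: qtangle
    and A :: "chord_diagram graded"
  assumes "1 \<le> m"
    and "is_framed_link m L"
    and "drinfeld_associator \<Phi>"
    and "A \<in> kontsevich \<Phi> m L"
  shows "(\<Sum>D\<in>chord_diagrams m k. Poly_Mapping.lookup (A k) D)
       = (\<Sum>S | S \<in> sym_mats m \<and> mat_size m S = k. ell_mat m L S)"
proof -
  let ?z = "lin_ext (closed_diagram m) (Z_tangle \<Phi> L k)"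
  have "is_qtangle L"
    using assms(2) by (simp add: is_framed_link_def)
  then have "Poly_Mapping.keys ?z \<subseteq> chord_diagrams m k"
    using closed_diagram_in_chord_diagrams[OF assms(2)] keys_Z_tangle
    by (auto elim!: keys_lin_ext_elim)
  have "(\<Sum>D\<in>chord_diagrams m k. Poly_Mapping.lookup (A k) D) = degree_sum m k (A k)"
    by (simp add: degree_sum_def)
  also have "\<dots> = degree_sum m k ?z"
    using assms(4) unfolding kontsevich_def by (rule degree_sum_class_A)
  \<comment> \<open>On this representative the support consists of diagrams of degree k, so the
    restricted sum is the full augmentation, which closing up preserves.\<close>
  also have "\<dots> = fps_nth (aug_series (Z_tangle \<Phi> L)) k"
    using \<open>Poly_Mapping.keys ?z \<subseteq> chord_diagrams m k\<close> by (simp add: degree_sum_eq_aug)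
  also have "\<dots> = (\<Sum>(i, j) | i \<le> j \<and> j < m. ell L i j) ^ k / fact k"
    using sum_ell[OF crossing_colours_less[OF assms(2)]] by (simp add: aug_Z_tangle[OF assms(3)])
  finally show ?thesis
    by (simp only: sum_sym_mats)
qed

end
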